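(* Let $\{\lambda_{\ell,k}\}_{1\le k\le N_x}$ be the eigenvalues of $\Phi_\ell$, $\ell=0,1,2$ (ordered according to common eigenvectors). Then the worst-case convergence factor $c_f$ of three-level MGRIT (V-cycle) with F-relaxation is bounded by $$c_f\le\sqrt{\|\mathcal{E}_F^{n_\ell=3,\Delta}\|_1\,\|\mathcal{E}_F^{n_\ell=3,\Delta}\|_\infty},$$ and the two norms are given analytically as follows. $\|\mathcal{E}_F^{n_\ell=3,\Delta}\|_1$ is the maximum, over $1\le k\le N_x$, of the quantities $$|\lambda_{2,k}-\lambda_{0,k}^{m_0}\lambda_{1,k}^{m_1-1}|\left(|\lambda_{2,k}|^{N_2-2}+\frac{1-|\lambda_{2,k}|^{N_2-2}}{1-|\lambda_{2,k}|}\,\frac{1-|\lambda_{1,k}|^{m_1}}{1-|\lambda_{1,k}|}\right)+|\lambda_{1,k}-\lambda_{0,k}^{m_0}|\frac{1-|\lambda_{1,k}|^{m_1-1}}{1-|\lambda_{1,k}|}$$ and, for $j=1,\dots,m_1-1$, $$|\lambda_{1,k}|^{j-1}|\lambda_{1,k}-\lambda_{0,k}^{m_0}|\left[|\lambda_{2,k}|^{N_2-2}+\frac{1-|\lambda_{2,k}|^{N_2-2}}{1-|\lambda_{2,k}|}\,\frac{1-|\lambda_{1,k}|^{m_1}}{1-|\lambda_{1,k}|}\right]+|\lambda_{1,k}-\lambda_{0,k}^{m_0}|\frac{1-|\lambda_{1,k}|^{m_1-2}}{1-|\lambda_{1,k}|}.$$ $\|\mathcal{E}_F^{n_\ell=3,\Delta}\|_\infty$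 is the maximum, over $1\le k\le N_x$, of the quantities $$|\lambda_{2,k}-\lambda_{0,k}^{m_0}\lambda_{1,k}^{m_1-1}|\frac{1-|\lambda_{2,k}|^{N_2-1}}{1-|\lambda_{2,k}|}+|\lambda_{1,k}-\lambda_{0,k}^{m_0}|\frac{1-|\lambda_{2,k}|^{N_2-1}}{1-|\lambda_{2,k}|}\,\frac{1-|\lambda_{1,k}|^{m_1-1}}{1-|\lambda_{1,k}|}$$ and, for $j=1,\dots,m_1-1$, $$\begin{aligned}&|\lambda_{1,k}-\lambda_{0,k}^{m_0}|\frac{1-|\lambda_{1,k}|^j}{1-|\lambda_{1,k}|}+|\lambda_{1,k}|^j\frac{1-|\lambda_{2,k}|^{N_2-2}}{1-|\lambda_{2,k}|}|\lambda_{2,k}-\lambda_{0,k}^{m_0}\lambda_{1,k}^{m_1-1}|\\&\quad+|\lambda_{1,k}|^j\frac{1-|\lambda_{2,k}|^{N_2-2}}{1-|\lambda_{2,k}|}|\lambda_{1,k}-\lambda_{0,k}^{m_0}|\frac{1-|\lambda_{1,k}|^{m_1-1}}{1-|\lambda_{1,k}|}.\end{aligned}$$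
   Context: Fix $N_x\ge1$, coarsening factors $m_0,m_1\in\mathbb{N}$, and $N_0$ such that $N_\ell=(N_{\ell-1}-1)/m_{\ell-1}+1$, $\ell=1,2$, are integers. The time-stepping operators on levels $0,1,2$ are $N_x\times N_x$ matrices diagonalizable by the same set of eigenvectors (the columns of a matrix $U$) and strongly stable (norm less than $1$), so that their eigenvalues satisfy $|\lambda_{\ell,k}|<1$. $\Phi_\ell$ denotes the diagonalized operator $\mathrm{diag}(\lambda_{\ell,1},\dots,\lambda_{\ell,N_x})$, and all operators below and their norms are formed with these diagonal $\Phi_\ell$; in terms of the original operators, $\|\cdot\|_2$ corresponds to the $(\widetilde U\widetilde U^* )^{-1}$-norm, with $\widetilde U$ block diagonal with blocks $U$, which is the ordinary $\ell^2$-norm if $U$ is unitary. Vectors on level $\ell$ consist of $N_\ell$ blocks of size $N_x$, indexed $0,\dots,N_\ell-1$. $\|\cdot\|_1$ and $\|\cdot\|_\infty$ are the maximum absolute column and row sum norms. - $A_\ell$ ($N_\ell\times N_\ell$ blocks) is block lower bidiagonal with $I$ on the block diagonal and $-\Phi_\ell$ on the first block subdiagonal. - $R_\ell$, $\ell=0,1$ ($N_{\ell+1}\times N_\ell$ blocks): block row $0$ has $I$ in block column $0$; block row $j\ge1$ has $\Phi_\ell^{m_\ell-i}$ in block column $(j-1)m_\ell+i$, $i=1,\dots,m_\ell$; zeros elsewhere. - $P_\ell$, $\ell=0,1$ ($N_\ell\times N_{\ell+1}$ blocks): block column $j$ has $\Phi_\ell^i$ in block row $jm_\ell+i$ for $0\le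 i\le m_\ell-1$, $jm_\ell+i\le N_\ell-1$; zeros elsewhere. - $R_{I_0}$ ($N_1\times N_0$ blocks): block row $j$ has $I$ in block column $jm_0$, zeros elsewhere. - $S_1$: the block columns of the identity on level $1$ whose block index is not a multiple of $m_1$ (F-points). The three-level V-cycle with F-relaxation has error propagator $\mathcal{E}_F^{n_\ell=3}=P_0\,\mathcal{E}_F^{n_\ell=3,\Delta}R_{I_0}$, where the level-$1$ error propagator is $$\mathcal{E}_F^{n_\ell=3,\Delta}=R_{I_0}\mathcal{E}_F^{n_\ell=3}P_0=I-\big[P_1A_2^{-1}R_1+S_1(S_1^TA_1S_1)^{-1}S_1^T\big]R_0A_0P_0.$$ The errors satisfy $\mathbf e_{i+1}=\mathcal{E}_F^{n_\ell=3}\mathbf e_i$, $i\in\mathbb{N}_0$, and $\mathbf r_i=A_0\mathbf e_i$ is the fine-grid residual (up to sign) at iteration $i$. The worst-case convergence factor is $c_f=\max_i\|\mathbf r_{i+1}\|_2/\|\mathbf r_i\|_2$.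
   Formalization: The exponent m_1-2 in the column-sum quantities is corrected to j-1 (as printed it gives only an upper bound if m_1>=3); the c_f bound is shown for i>=1, and for i>=0 only if e_0=P_0 R_{I_0} e_0, since the first step can violate it; N_2>=2 is assumed. *)

theory Defs
  imports "HOL-Analysis.L2_Norm" "Jordan_Normal_Form.Gauss_Jordan_Elimination"
begin

text \<open>Block indices and indices inside a block both start at 0, so the paper's eigenvalue index
  \<open>1 \<le> k \<le> N\<^sub>x\<close> becomes \<open>k < Nx\<close>, and \<open>lam l k\<close> is the \<open>k\<close>-th eigenvalue on level \<open>l\<close>.
  \<open>m l\<close> and \<open>N l\<close> are the coarsening factor and the number of time points of level \<open>l\<close>.\<close>

definition block_mat :: "nat \<Rightarrow> nat \<Rightarrow> nat \<Rightarrow> (nat \<Rightarrow> nat \<Rightarrow> complex mat) \<Rightarrow> complex mat" where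
  "block_mat Nx nr nc B =
     mat (nr * Nx) (nc * Nx) (\<lambda>(i, j). B (i div Nx) (j div Nx) $$ (i mod Nx, j mod Nx))"

definition Phi :: "nat \<Rightarrow> (nat \<Rightarrow> nat \<Rightarrow> complex) \<Rightarrow> nat \<Rightarrow> complex mat" where
  "Phi Nx lam l = mat_diag Nx (lam l)"

definition A_op :: "nat \<Rightarrow> (nat \<Rightarrow> nat) \<Rightarrow> (nat \<Rightarrow> nat \<Rightarrow> complex) \<Rightarrow> nat \<Rightarrow> complex mat" where
  "A_op Nx N lam l = block_mat Nx (N l) (N l) (\<lambda>i j.
     if i = j then 1\<^sub>m Nx else if i = j + 1 then - Phi Nx lam l else 0\<^sub>m Nx Nx)"

text \<open>In block row \<open>j \<ge> 1\<close> of the restriction, block column \<open>c = (j - 1) m + i\<close> with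
  \<open>1 \<le> i \<le> m\<close> carries the exponent \<open>m - i = j m - c\<close>.\<close>

definition R_op ::
  "nat \<Rightarrow> (nat \<Rightarrow> nat) \<Rightarrow> (nat \<Rightarrow> nat) \<Rightarrow> (nat \<Rightarrow> nat \<Rightarrow> complex) \<Rightarrow> nat \<Rightarrow> complex mat" where
  "R_op Nx m N lam l = block_mat Nx (N (Suc l)) (N l) (\<lambda>j c.
     if j = 0 then (if c = 0 then 1\<^sub>m Nx else 0\<^sub>m Nx Nx)
     else if (j - 1) * m l < c \<and> c \<le> j * m l then Phi Nx lam l ^\<^sub>m (j * m l - c)
     else 0\<^sub>m Nx Nx)"

definition P_op ::
  "nat \<Rightarrow> (nat \<Rightarrow> nat) \<Rightarrow> (nat \<Rightarrow> nat) \<Rightarrow> (nat \<Rightarrow> nat \<Rightarrow> complex) \<Rightarrow> nat \<Rightarrow> complex mat" where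
  "P_op Nx m N lam l = block_mat Nx (N l) (N (Suc l)) (\<lambda>r j.
     if j * m l \<le> r \<and> r \<le> j * m l + (m l - 1) then Phi Nx lam l ^\<^sub>m (r - j * m l)
     else 0\<^sub>m Nx Nx)"

definition RI0_op :: "nat \<Rightarrow> (nat \<Rightarrow> nat) \<Rightarrow> (nat \<Rightarrow> nat) \<Rightarrow> complex mat" where
  "RI0_op Nx m N = block_mat Nx (N 1) (N 0) (\<lambda>j c. if c = j * m 0 then 1\<^sub>m Nx else 0\<^sub>m Nx Nx)"

definition F_points1 :: "(nat \<Rightarrow> nat) \<Rightarrow> (nat \<Rightarrow> nat) \<Rightarrow> nat list" where
  "F_points1 m N = filter (\<lambda>i. \<not> m 1 dvd i) [0..<N 1]"

definition S1_op :: "nat \<Rightarrow> (nat \<Rightarrow> nat) \<Rightarrow> (nat \<Rightarrow> nat) \<Rightarrow> complex mat" where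
  "S1_op Nx m N = block_mat Nx (N 1) (length (F_points1 m N)) (\<lambda>i j.
     if i = F_points1 m N ! j then 1\<^sub>m Nx else 0\<^sub>m Nx Nx)"

abbreviation minv :: "complex mat \<Rightarrow> complex mat" where
  "minv M \<equiv> the (mat_inverse M)"

definition E_Delta ::
  "nat \<Rightarrow> (nat \<Rightarrow> nat) \<Rightarrow> (nat \<Rightarrow> nat) \<Rightarrow> (nat \<Rightarrow> nat \<Rightarrow> complex) \<Rightarrow> complex mat" where
  "E_Delta Nx m N lam =
     1\<^sub>m (N 1 * Nx) -
     (P_op Nx m N lam 1 * minv (A_op Nx N lam 2) * R_op Nx m N lam 1 +
      S1_op Nx m N *
        minv (transpose_mat (S1_op Nx m N) * A_op Nx N lam 1 * S1_op Nx m N) *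
        transpose_mat (S1_op Nx m N)) *
     (R_op Nx m N lam 0 * A_op Nx N lam 0 * P_op Nx m N lam 0)"

definition E_F ::
  "nat \<Rightarrow> (nat \<Rightarrow> nat) \<Rightarrow> (nat \<Rightarrow> nat) \<Rightarrow> (nat \<Rightarrow> nat \<Rightarrow> complex) \<Rightarrow> complex mat" where
  "E_F Nx m N lam = P_op Nx m N lam 0 * E_Delta Nx m N lam * RI0_op Nx m N"

definition mat_norm_1 :: "complex mat \<Rightarrow> real" where
  "mat_norm_1 M = Max ((\<lambda>j. \<Sum>i<dim_row M. cmod (M $$ (i, j))) ` {..<dim_col M})"

definition mat_norm_inf :: "complex mat \<Rightarrow> real" where
  "mat_norm_inf M = Max ((\<lambda>i. \<Sum>j<dim_col M. cmod (M $$ (i, j))) ` {..<dim_row M})"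

definition vec_norm_2 :: "complex vec \<Rightarrow> real" where
  "vec_norm_2 v = L2_set (\<lambda>i. cmod (v $ i)) {..<dim_vec v}"

text \<open>The worst-case convergence factor of a sequence of errors \<open>e\<close> for the system matrix \<open>A\<close>.
  The error propagator is nilpotent, so the residual vanishes after finitely many
  iterations; the ratio is then \<open>0 / 0 = 0\<close>, and the supremum is a maximum.

  For an arbitrary initial error the bound of the theorem is valid from the first iterate on,
  i.e. for \<open>\<lambda>i. e (Suc i)\<close>. It covers the step from the initial residual too if that residual
  vanishes at the F-points, i.e. if the initial error is \<open>P\<^sub>0 R\<^sub>I\<^sub>0 e\<^sub>0\<close>. Otherwise that step
  can exceed it: \<open>N\<^sub>x = m\<^sub>1 = 1\<close>, \<open>m\<^sub>0 = 2\<close>, \<open>N\<^sub>2 = 3\<close>, eigenvalues 1/2, 1/4, 0 and initial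
  residual (0, 1/2, 1, 0, 0) give the ratio \<open>sqrt 5 / 8\<close> and the bound 1/4.\<close>

definition conv_factor :: "complex mat \<Rightarrow> (nat \<Rightarrow> complex vec) \<Rightarrow> real" where
  "conv_factor A e = (SUP i. vec_norm_2 (A *\<^sub>v e (Suc i)) / vec_norm_2 (A *\<^sub>v e i))"

definition geom :: "complex \<Rightarrow> nat \<Rightarrow> real" where
  "geom z n = (1 - cmod z ^ n) / (1 - cmod z)"

text \<open>The quantities below have as arguments \<open>m\<^sub>0\<close>, \<open>m\<^sub>1\<close>, \<open>N\<^sub>2\<close> and the eigenvalues
  \<open>a\<close>, \<open>b\<close>, \<open>c\<close> on the levels 0, 1, 2 that belong to one common eigenvector.
  \<open>col_C\<close> and \<open>col_F\<close> enter the 1-norm; \<open>row_C\<close> and \<open>row_F\<close> the infinity norm.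

  The exponent \<open>p\<close> in the last summand of \<open>col_F\<close> is \<open>m\<^sub>1 - 2\<close> in the paper. The
  column sum has \<open>p = j - 1\<close> instead; both agree for \<open>j = m\<^sub>1 - 1\<close>. With \<open>p = m\<^sub>1 - 2\<close>
  for every \<open>j\<close> the maximum is only an upper bound of the 1-norm if \<open>m\<^sub>1 \<ge> 3\<close>:
  for \<open>N\<^sub>x = m\<^sub>0 = 1\<close>, \<open>m\<^sub>1 = 3\<close>, \<open>N\<^sub>2 = 2\<close>, \<open>a = c = 0\<close>, \<open>b = 1/2\<close> it is 1,
  and the norm is 3/4.\<close>

definition col_C :: "nat \<Rightarrow> nat \<Rightarrow> nat \<Rightarrow> complex \<Rightarrow> complex \<Rightarrow> complex \<Rightarrow> real" where
  "col_C m0 m1 N2 a b c =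
     cmod (c - a ^ m0 * b ^ (m1 - 1)) * (cmod c ^ (N2 - 2) + geom c (N2 - 2) * geom b m1) +
     cmod (b - a ^ m0) * geom b (m1 - 1)"

definition col_F ::
  "nat \<Rightarrow> nat \<Rightarrow> nat \<Rightarrow> nat \<Rightarrow> complex \<Rightarrow> complex \<Rightarrow> complex \<Rightarrow> nat \<Rightarrow> real" where
  "col_F p m0 m1 N2 a b c j =
     cmod b ^ (j - 1) * cmod (b - a ^ m0) *
       (cmod c ^ (N2 - 2) + geom c (N2 - 2) * geom b m1) +
     cmod (b - a ^ m0) * geom b p"

definition row_C :: "nat \<Rightarrow> nat \<Rightarrow> nat \<Rightarrow> complex \<Rightarrow> complex \<Rightarrow> complex \<Rightarrow> real" where
  "row_C m0 m1 N2 a b c =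
     cmod (c - a ^ m0 * b ^ (m1 - 1)) * geom c (N2 - 1) +
     cmod (b - a ^ m0) * geom c (N2 - 1) * geom b (m1 - 1)"

definition row_F :: "nat \<Rightarrow> nat \<Rightarrow> nat \<Rightarrow> complex \<Rightarrow> complex \<Rightarrow> complex \<Rightarrow> nat \<Rightarrow> real" where
  "row_F m0 m1 N2 a b c j =
     cmod (b - a ^ m0) * geom b j +
     cmod b ^ j * geom c (N2 - 2) * cmod (c - a ^ m0 * b ^ (m1 - 1)) +
     cmod b ^ j * geom c (N2 - 2) * cmod (b - a ^ m0) * geom b (m1 - 1)"

definition max_col_sum ::
  "(nat \<Rightarrow> nat) \<Rightarrow> nat \<Rightarrow> nat \<Rightarrow> nat \<Rightarrow> nat \<Rightarrow> (nat \<Rightarrow> nat \<Rightarrow> complex) \<Rightarrow> real" where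
  "max_col_sum p Nx m0 m1 N2 lam = Max (\<Union>k<Nx.
     insert (col_C m0 m1 N2 (lam 0 k) (lam 1 k) (lam 2 k))
       ((\<lambda>j. col_F (p j) m0 m1 N2 (lam 0 k) (lam 1 k) (lam 2 k) j) ` {1..m1 - 1}))"

definition max_row_sum ::
  "nat \<Rightarrow> nat \<Rightarrow> nat \<Rightarrow> nat \<Rightarrow> (nat \<Rightarrow> nat \<Rightarrow> complex) \<Rightarrow> real" where
  "max_row_sum Nx m0 m1 N2 lam = Max (\<Union>k<Nx.
     insert (row_C m0 m1 N2 (lam 0 k) (lam 1 k) (lam 2 k))
       (row_F m0 m1 N2 (lam 0 k) (lam 1 k) (lam 2 k) ` {1..m1 - 1}))"

end

theory Submission
  imports Defs "Jordan_Normal_Form.Determinant"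
begin

text \<open>All operators have diagonal blocks, so they decouple into scalar matrices, one for each
  common eigenvector. Let \<open>B = R\<^sub>0 A\<^sub>0 P\<^sub>0\<close>, which is bidiagonal with subdiagonal
  \<open>- \<lambda>\<^sub>0\<^bsup>m\<^sub>0\<^esup>\<close>, and let \<open>M\<close> be the bracket in the level-1 error propagator
  \<open>E = I - M B\<close>. The entries of \<open>M\<close> and \<open>E\<close> are explicit, and the column (row) sums of \<open>E\<close>
  increase towards the first (last) coarse interval, which gives the two norms.

  Since \<open>A\<^sub>0 P\<^sub>0\<close> is \<open>B\<close> followed by the isometric injection \<open>R\<^sub>I\<^sub>0\<^sup>T\<close>, residuals are propagated by
  \<open>G\<close> with \<open>B E = G B\<close>, i.e. \<open>G = I - B M\<close>. Both \<open>M\<close> and \<open>B\<close> are persymmetric, so \<open>G\<close> is \<open>E\<close>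
  reflected in the antidiagonal; this swaps the 1-norm and the infinity norm, and the Schur test
  for \<open>G\<close> yields the bound on the convergence factor.\<close>

section \<open>Block matrices with diagonal blocks\<close>

text \<open>The eigenvector index comes first, so that \<open>f k\<close> is the scalar matrix
  acting on the \<open>k\<close>-th common eigenvector; the matrix operations below work on each
  \<open>f k\<close> separately.\<close>

definition diag_blocks ::
  "nat \<Rightarrow> nat \<Rightarrow> nat \<Rightarrow> (nat \<Rightarrow> nat \<Rightarrow> nat \<Rightarrow> complex) \<Rightarrow> complex mat" where
  "diag_blocks Nx nr nc f = block_mat Nx nr nc (\<lambda>i j. mat_diag Nx (\<lambda>k. f k i j))"

lemma diag_blocks_carrier [simp]: "diag_blocks Nx nr nc f \<in> carrier_mat (nr * Nx) (nc * Nx)"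
  and dim_row_diag_blocks [simp]: "dim_row (diag_blocks Nx nr nc f) = nr * Nx"
  and dim_col_diag_blocks [simp]: "dim_col (diag_blocks Nx nr nc f) = nc * Nx"
  by (simp_all add: diag_blocks_def block_mat_def)

lemma div_less_block: "i < n * Nx \<Longrightarrow> i div Nx < (n :: nat)"
  by (simp add: less_mult_imp_div_less)

lemma mod_less_block: "i < n * Nx \<Longrightarrow> i mod Nx < (Nx :: nat)"
  by (cases Nx) auto

lemma block_less: "r < n \<Longrightarrow> k < Nx \<Longrightarrow> r * Nx + k < n * (Nx :: nat)"
proof -
  assume "r < n" "k < Nx"
  then have "r * Nx + k < Suc r * Nx" by simp
  also have "\<dots> \<le> n * Nx"
    using \<open>r < n\<close> by (intro mult_le_mono1) simp
  finally show ?thesis .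
qed

lemma diag_blocks_index:
  assumes "i < nr * Nx" and "j < nc * Nx"
  shows "diag_blocks Nx nr nc f $$ (i, j) =
    (if i mod Nx = j mod Nx then f (j mod Nx) (i div Nx) (j div Nx) else 0)"
  using assms mod_less_block[OF assms(1)] mod_less_block[OF assms(2)]
  by (simp add: diag_blocks_def block_mat_def mat_diag_def)

lemma diag_blocks_index':
  assumes "r < nr" and "c < nc" and "k < Nx" and "l < Nx"
  shows "diag_blocks Nx nr nc f $$ (r * Nx + k, c * Nx + l) = (if k = l then f k r c else 0)"
  using assms block_less[OF assms(1,3)] block_less[OF assms(2,4)]
  by (simp add: diag_blocks_index)

lemma block_mat_eq_diag_blocks:
  assumes "\<And>i j. i < nr \<Longrightarrow> j < nc \<Longrightarrow> B i j = mat_diag Nx (\<lambda>k. f k i j)"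
  shows "block_mat Nx nr nc B = diag_blocks Nx nr nc f"
  unfolding diag_blocks_def block_mat_def
  by (rule eq_matI) (auto simp: assms div_less_block)

lemma diag_blocks_cong:
  assumes "\<And>k i j. k < Nx \<Longrightarrow> i < nr \<Longrightarrow> j < nc \<Longrightarrow> f k i j = g k i j"
  shows "diag_blocks Nx nr nc f = diag_blocks Nx nr nc g"
  by (rule eq_matI) (auto simp: diag_blocks_index assms div_less_block mod_less_block)

lemma sum_blocks:
  fixes g :: "nat \<Rightarrow> 'a::comm_monoid_add"
  shows "(\<Sum>i<n * Nx. g i) = (\<Sum>r<n. \<Sum>k<Nx. g (r * Nx + k))"
proof -
  have "(\<Sum>i<n * Nx. g i) = (\<Sum>r<n. sum g {r * Nx..<r * Nx + Nx})"
    by (rule sum.nat_group[symmetric])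
  also have "\<dots> = (\<Sum>r<n. \<Sum>k<Nx. g (r * Nx + k))"
  proof (rule sum.cong[OF refl])
    fix r
    show "sum g {r * Nx..<r * Nx + Nx} = (\<Sum>k<Nx. g (r * Nx + k))"
      by (rule sum.reindex_bij_witness[of _ "\<lambda>k. r * Nx + k" "\<lambda>i. i - r * Nx"]) auto
  qed
  finally show ?thesis .
qed

lemma diag_blocks_mult:
  "diag_blocks Nx nr n f * diag_blocks Nx n nc g =
     diag_blocks Nx nr nc (\<lambda>k i j. \<Sum>l<n. f k i l * g k l j)"
proof (rule eq_matI)
  fix i j
  assume "i < dim_row (diag_blocks Nx nr nc (\<lambda>k i j. \<Sum>l<n. f k i l * g k l j))"
    and "j < dim_col (diag_blocks Nx nr nc (\<lambda>k i j. \<Sum>l<n. f k i l * g k l j))"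
  then have i: "i < nr * Nx" and j: "j < nc * Nx"
    by simp_all
  note k = mod_less_block[OF i] mod_less_block[OF j]
  have "(diag_blocks Nx nr n f * diag_blocks Nx n nc g) $$ (i, j) =
      (\<Sum>l<n * Nx. diag_blocks Nx nr n f $$ (i, l) * diag_blocks Nx n nc g $$ (l, j))"
    using i j by (simp add: scalar_prod_def lessThan_atLeast0)
  \<comment> \<open>Diagonal blocks leave only the offset \<open>j mod Nx\<close> in each block of
    the summation index; this delta form lets the inner sum collapse.\<close>
  also have "\<dots> = (\<Sum>r<n. \<Sum>k<Nx. if k = j mod Nx then
      (if i mod Nx = j mod Nx then f (j mod Nx) (i div Nx) r * g (j mod Nx) r (j div Nx) else 0)
      else 0)"
    unfolding sum_blocks using i j
    by (intro sum.cong refl) (auto simp: diag_blocks_index block_less)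
  also have "\<dots> = (if i mod Nx = j mod Nx then
      (\<Sum>l<n. f (j mod Nx) (i div Nx) l * g (j mod Nx) l (j div Nx)) else 0)"
    using k by (simp add: sum.delta')
  finally show "(diag_blocks Nx nr n f * diag_blocks Nx n nc g) $$ (i, j) =
      diag_blocks Nx nr nc (\<lambda>k i j. \<Sum>l<n. f k i l * g k l j) $$ (i, j)"
    using i j by (simp add: diag_blocks_index)
qed simp_all

lemma diag_blocks_add:
  "diag_blocks Nx nr nc f + diag_blocks Nx nr nc g =
     diag_blocks Nx nr nc (\<lambda>k i j. f k i j + g k i j)"
  by (rule eq_matI) (auto simp: diag_blocks_index)

lemma diag_blocks_minus:
  "diag_blocks Nx nr nc f - diag_blocks Nx nr nc g =
     diag_blocks Nx nr nc (\<lambda>k i j. f k i j - g k i j)"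
  by (rule eq_matI) (auto simp: diag_blocks_index)

lemma diag_blocks_transpose:
  "transpose_mat (diag_blocks Nx nr nc f) = diag_blocks Nx nc nr (\<lambda>k i j. f k j i)"
  by (rule eq_matI) (auto simp: diag_blocks_index)

lemma one_mat_diag_blocks: "1\<^sub>m (n * Nx) = diag_blocks Nx n n (\<lambda>k i j. if i = j then 1 else 0)"
  by (rule eq_matI) (auto simp: diag_blocks_index, metis div_mult_mod_eq)

text \<open>A right inverse of a square matrix over a field is two-sided, so \<open>A\<close> is a
  unit and \<open>mat_inverse\<close> cannot return \<open>None\<close>; uniqueness of inverses
  identifies the result.\<close>

lemma mat_inverse_eqI:
  assumes A: "A \<in> carrier_mat n n" and B: "B \<in> carrier_mat n n" and AB: "A * B = 1\<^sub>m n"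
  shows "mat_inverse A = Some B"
proof -
  have BA: "B * A = 1\<^sub>m n"
    using mat_mult_left_right_inverse[OF A B AB] .
  have "A \<in> Units (ring_mat TYPE('a) n ())"
    using A B AB BA by (auto simp: Units_def ring_mat_def)
  then obtain C where C: "mat_inverse A = Some C"
    using mat_inverse(1)[OF A, of "()"] by (cases "mat_inverse A") auto
  then have "A * C = 1\<^sub>m n" "C \<in> carrier_mat n n"
    using mat_inverse(2)[OF A] by auto
  then have "C = B"
    using assoc_mult_mat[OF B A, of C n] B BA by simp
  with C show ?thesis by simp
qed

lemma mat_diag_power: "mat_diag n f ^\<^sub>m p = mat_diag n (\<lambda>k. f k ^ p)"
  by (induction p) (simp_all add: carrier_matD(1)[OF mat_diag_dim] flip: power_Suc2)

lemma zero_mat_diag: "0\<^sub>m n n = mat_diag n (\<lambda>_. 0)"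
  and uminus_mat_diag: "- mat_diag n f = mat_diag n (\<lambda>k. - f k :: 'a :: group_add)"
  by (auto simp: mat_diag_def intro!: eq_matI)

section \<open>The multigrid operators for a single eigenvalue index\<close>

definition bidiag :: "complex \<Rightarrow> nat \<Rightarrow> nat \<Rightarrow> complex" where
  "bidiag z i j = (if i = j then 1 else if i = j + 1 then - z else 0)"

definition restr :: "nat \<Rightarrow> complex \<Rightarrow> nat \<Rightarrow> nat \<Rightarrow> complex" where
  "restr m z j c =
     (if j = 0 then (if c = 0 then 1 else 0)
      else if (j - 1) * m < c \<and> c \<le> j * m then z ^ (j * m - c) else 0)"

definition prolong :: "nat \<Rightarrow> complex \<Rightarrow> nat \<Rightarrow> nat \<Rightarrow> complex" where
  "prolong m z r j = (if j * m \<le> r \<and> r \<le> j * m + (m - 1) then z ^ (r - j * m) else 0)"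

lemma A_op_diag: "A_op Nx N lam l = diag_blocks Nx (N l) (N l) (\<lambda>k. bidiag (lam l k))"
  unfolding A_op_def Phi_def
  by (rule block_mat_eq_diag_blocks) (auto simp: bidiag_def zero_mat_diag uminus_mat_diag)

lemma R_op_diag:
  "R_op Nx m N lam l = diag_blocks Nx (N (Suc l)) (N l) (\<lambda>k. restr (m l) (lam l k))"
  unfolding R_op_def Phi_def
  by (rule block_mat_eq_diag_blocks) (auto simp: restr_def zero_mat_diag mat_diag_power)

lemma P_op_diag:
  "P_op Nx m N lam l = diag_blocks Nx (N l) (N (Suc l)) (\<lambda>k. prolong (m l) (lam l k))"
  unfolding P_op_def Phi_def
  by (rule block_mat_eq_diag_blocks) (auto simp: prolong_def zero_mat_diag mat_diag_power)

lemma RI0_op_diag: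
  "RI0_op Nx m N = diag_blocks Nx (N 1) (N 0) (\<lambda>k i j. if j = i * m 0 then 1 else 0)"
  unfolding RI0_op_def by (rule block_mat_eq_diag_blocks) (auto simp: zero_mat_diag)

lemma S1_op_diag:
  "S1_op Nx m N = diag_blocks Nx (N 1) (length (F_points1 m N))
     (\<lambda>k i j. if i = F_points1 m N ! j then 1 else 0)"
  unfolding S1_op_def by (rule block_mat_eq_diag_blocks) (auto simp: zero_mat_diag)

section \<open>Scalar products with the bidiagonal, prolongation and restriction matrices\<close>

lemma bidiag_mult_left:
  assumes "i < n"
  shows "(\<Sum>l<n. bidiag z i l * g l) = g i - (if i = 0 then 0 else z * g (i - 1))"
proof -
  have "bidiag z i l * g l =
      (if l = i then g l else 0) - (if l = i - 1 then (if i = 0 then 0 else z * g l) else 0)" for l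
    by (auto simp: bidiag_def)
  then show ?thesis
    using assms by (simp add: sum_subtractf sum.delta)
qed

lemma bidiag_mult_right:
  assumes "j < n"
  shows "(\<Sum>l<n. g l * bidiag z l j) = g j - (if j + 1 < n then z * g (j + 1) else 0)"
proof -
  have "g l * bidiag z l j = (if l = j then g l else 0) - (if l = j + 1 then z * g l else 0)" for l
    by (auto simp: bidiag_def)
  then show ?thesis
    using assms by (simp add: sum_subtractf sum.delta)
qed

text \<open>A column of the prolongation follows the time-stepping recurrence inside its coarse
  interval and is annihilated there. What remains is its start and the drop after
  \<open>z ^ (m - 1)\<close> to zero at the next C-point.\<close>

lemma bidiag_prolong:
  assumes m: "m \<ge> 1" and x: "x < n"
  shows "(\<Sum>l<n. bidiag z x l * prolong m z l j) =
    (if x = j * m then 1 else 0) - (if x = (j + 1) * m then z ^ m else 0)"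
proof -
  consider "x < j * m" | "x = j * m" | "j * m < x" "x < j * m + m" | "x = j * m + m"
    | "x > j * m + m"
    by linarith
  then show ?thesis
  proof cases
    case 2
    with m show ?thesis
      unfolding bidiag_mult_left[OF x] by (cases "j * m") (auto simp: prolong_def)
  next
    case 3
    then have "z ^ (x - j * m) = z * z ^ (x - Suc (j * m))"
      by (metis Suc_diff_Suc power_Suc)
    with 3 m show ?thesis
      unfolding bidiag_mult_left[OF x] by (auto simp: prolong_def)
  next
    case 4
    have "z ^ m = z * z ^ (m - 1)"
      using m by (cases m) auto
    with 4 m show ?thesis
      unfolding bidiag_mult_left[OF x] by (auto simp: prolong_def)
  qed (use m in \<open>unfold bidiag_mult_left[OF x], auto simp: prolong_def\<close>)
qed

text \<open>Row \<open>i > 0\<close> of the restriction covers the columns from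
  \<open>(i - 1) * m + 1\<close> to \<open>i * m\<close>; the only C-point among them is the right
  end, with exponent zero.\<close>

lemma restr_C_point:
  assumes "m \<ge> 1"
  shows "restr m z i (j * m) = (if i = j then 1 else 0)"
proof (cases i)
  case (Suc i')
  have "i' * m < j * m \<longleftrightarrow> i' < j" "j * m \<le> i * m \<longleftrightarrow> j \<le> i"
    using assms by auto
  with Suc show ?thesis
    by (auto simp: restr_def)
qed (use assms in \<open>auto simp: restr_def\<close>)

lemma prolong_div_mod:
  assumes "m \<ge> 1"
  shows "prolong m z r j = (if j = r div m then z ^ (r mod m) else 0)"
proof -
  have "j * m \<le> r \<and> r \<le> j * m + (m - 1) \<longleftrightarrow> j = r div m"
  proof
    assume "j * m \<le> r \<and> r \<le> j * m + (m - 1)"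
    then show "j = r div m"
      using assms by (intro div_nat_eqI[symmetric]) (auto simp: mult.commute)
  next
    assume "j = r div m"
    then have "j * m = r div m * m"
      by simp
    moreover have "r mod m < m"
      using assms by simp
    moreover have "r = r div m * m + r mod m"
      by simp
    ultimately show "j * m \<le> r \<and> r \<le> j * m + (m - 1)"
      by linarith
  qed
  then show ?thesis
    by (auto simp: prolong_def minus_div_mult_eq_mod)
qed

text \<open>The intervals are closed at the right end, unlike those of the prolongation: an F-point
  \<open>s\<close> belongs to the row after \<open>s div m\<close>, a C-point to row
  \<open>s div m\<close> itself.\<close>

lemma restr_div_mod:
  assumes m: "m \<ge> 1"
  shows "restr m z j s =
    (if s mod m = 0 then (if j = s div m then 1 else 0)
     else if j = s div m + 1 then z ^ (m - s mod m) else 0)"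
proof (cases "s mod m = 0")
  case True
  then obtain q where "s = q * m"
    by (metis dvd_div_mult_self mod_0_imp_dvd)
  then show ?thesis
    using m by (simp add: restr_C_point)
next
  case False
  define q u where "q = s div m" and "u = s mod m"
  have s: "s = q * m + u" and u: "0 < u" "u < m"
    using False m by (auto simp: q_def u_def)
  have 1: "i * m < s \<longleftrightarrow> i \<le> q" for i
  proof
    assume "i * m < s"
    then have "i * m < (q + 1) * m" using s u by simp
    then show "i \<le> q" using mult_less_cancel2 by (metis Suc_eq_plus1 less_Suc_eq_le)
  next
    assume "i \<le> q"
    then have "i * m \<le> q * m" by simp
    then show "i * m < s" using s u by linarith
  qed
  have 2: "s \<le> j * m \<longleftrightarrow> q < j"
    using 1[of j] by (metis not_le)
  have "j = 0 \<Longrightarrow> s \<noteq> 0 \<and> j \<noteq> q + 1"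
    using s u by auto
  moreover have "(q + 1) * m - s = m - u"
    using s u by simp
  moreover have "j \<noteq> 0 \<Longrightarrow> (j - 1) * m < s \<and> s \<le> j * m \<longleftrightarrow> j = q + 1"
    unfolding 1 2 by auto
  ultimately show ?thesis
    using False by (auto simp: restr_def q_def[symmetric] u_def[symmetric])
qed

text \<open>The inverse of \<open>bidiag z\<close>: \<open>i - j\<close> time steps lead from point
  \<open>j\<close> to point \<open>i\<close>.\<close>

definition lower_powers :: "complex \<Rightarrow> nat \<Rightarrow> nat \<Rightarrow> complex" where
  "lower_powers z i j = (if j \<le> i then z ^ (i - j) else 0)"

text \<open>The inverse of the FF-block of the bidiagonal matrix, extended by zero to all points.\<close>

definition F_solve :: "nat \<Rightarrow> complex \<Rightarrow> nat \<Rightarrow> nat \<Rightarrow> complex" where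
  "F_solve m z r s =
     (if \<not> m dvd r \<and> \<not> m dvd s \<and> r div m = s div m \<and> s \<le> r then z ^ (r - s) else 0)"

lemma bidiag_lower_powers:
  assumes "i < n"
  shows "(\<Sum>l<n. bidiag z i l * lower_powers z l j) = (if i = j then 1 else 0)"
proof -
  have "z ^ (i - j) = z * z ^ (i - 1 - j)" if "j < i"
    using that by (metis Suc_diff_Suc diff_Suc_eq_diff_pred power_Suc)
  then show ?thesis
    unfolding bidiag_mult_left[OF assms] by (cases i j rule: linorder_cases) (auto simp: lower_powers_def)
qed

text \<open>The predecessor of an F-point lies in the same coarse interval. It is either an F-point,
  and the recurrence works as for \<open>lower_powers\<close>, or the C-point at the left end, where
  \<open>F_solve\<close> is zero.\<close>

lemma bidiag_F_solve:
  assumes i: "i < n" and F: "\<not> m dvd i" "\<not> m dvd j"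
  shows "(\<Sum>l<n. bidiag z i l * F_solve m z l j) = (if i = j then 1 else 0)"
proof -
  have i0: "i \<noteq> 0"
    using F by (metis dvd_0_right)
  then obtain i' where i': "i = Suc i'"
    by (cases i) auto
  have div: "i' div m = i div m"
    using F unfolding i' by (simp add: div_Suc dvd_eq_mod_eq_0)
  \<comment> \<open>A C-point \<open>i'\<close> would be the left end of the interval of
    \<open>j\<close>; then \<open>j \<le> i'\<close> forces \<open>j = i'\<close>, contradicting
    that \<open>j\<close> is an F-point.\<close>
  have *: "\<not> m dvd i'" if "i' div m = j div m" "j \<le> i'"
  proof
    assume "m dvd i'"
    then have "i' = m * (j div m)"
      using that by (metis dvd_mult_div_cancel)
    then have "j = i'"
      using that by (metis le_antisym times_div_less_eq_dividend)
    with F \<open>m dvd i'\<close> show False by simp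
  qed
  have "z ^ (i - j) = z * z ^ (i' - j)" if "j \<le> i'"
    using that by (simp add: i' Suc_diff_le)
  then show ?thesis
    unfolding bidiag_mult_left[OF i] using F i0 * div
    by (cases i j rule: linorder_cases) (auto simp: F_solve_def i')
qed

text \<open>For a single eigenvalue index, \<open>approx_inv m\<^sub>1 b c\<close> is the matrix
  \<open>M = P\<^sub>1 A\<^sub>2\<^sup>-\<^sup>1 R\<^sub>1 + S\<^sub>1 (S\<^sub>1\<^sup>T A\<^sub>1 S\<^sub>1)\<^sup>-\<^sup>1 S\<^sub>1\<^sup>T\<close>. The supports of the two
  summands are disjoint.\<close>

definition approx_inv :: "nat \<Rightarrow> complex \<Rightarrow> complex \<Rightarrow> nat \<Rightarrow> nat \<Rightarrow> complex" where
  "approx_inv m b c r s =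
     (if s mod m = 0 then
        (if s div m \<le> r div m then b ^ (r mod m) * c ^ (r div m - s div m) else 0)
      else if r div m = s div m then
        (if s mod m \<le> r mod m then b ^ (r mod m - s mod m) else 0)
      else if s div m < r div m then
        b ^ (r mod m + m - s mod m) * c ^ (r div m - s div m - 1)
      else 0)"

text \<open>Both sums collapse: row \<open>r\<close> meets only the coarse point
  \<open>r div m\<close>, and column \<open>s\<close> only \<open>s div m\<close> or, if
  \<open>s\<close> is an F-point, the coarse point after it. In the second case the coarse term
  begins in the interval after the one where \<open>F_solve\<close> lives.\<close>

lemma coarse_correction:
  assumes m: "m \<ge> 1" and r: "r < n * m + 1" and s: "s < n * m + 1"
  shows "(\<Sum>j<n + 1. (\<Sum>i<n + 1. prolong m b r i * lower_powers c i j) * restr m b j s) +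
    F_solve m b r s = approx_inv m b c r s"
proof -
  have rn: "r div m < n + 1"
    using r m by (metis less_Suc_eq_le Suc_eq_plus1 div_le_mono nonzero_mult_div_cancel_right not_one_le_zero)
  have sn: "s div m < n + 1"
    using s m by (metis less_Suc_eq_le Suc_eq_plus1 div_le_mono nonzero_mult_div_cancel_right not_one_le_zero)
  \<comment> \<open>The quotient \<open>n\<close> occurs only at the C-point \<open>n * m\<close>,
    so an F-point always has a coarse point to its right.\<close>
  have sn': "s div m + 1 < n + 1" if "s mod m \<noteq> 0"
  proof -
    have "s div m * m < n * m"
      using s that div_mult_mod_eq[of s m] by linarith
    then show ?thesis by simp
  qed
  have 1: "(\<Sum>i<n + 1. prolong m b r i * lower_powers c i j) =
      b ^ (r mod m) * lower_powers c (r div m) j" for j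
  proof -
    have "(\<Sum>i<n + 1. prolong m b r i * lower_powers c i j) =
        (\<Sum>i<n + 1. if i = r div m then b ^ (r mod m) * lower_powers c i j else 0)"
      using m by (intro sum.cong) (auto simp: prolong_div_mod)
    then show ?thesis
      using rn by (simp add: sum.delta')
  qed
  have 2: "(\<Sum>j<n + 1. b ^ (r mod m) * lower_powers c (r div m) j * restr m b j s) =
     (if s mod m = 0 then b ^ (r mod m) * lower_powers c (r div m) (s div m)
      else b ^ (r mod m) * lower_powers c (r div m) (s div m + 1) * b ^ (m - s mod m))"
  proof (cases "s mod m = 0")
    case True
    then have "(\<Sum>j<n + 1. b ^ (r mod m) * lower_powers c (r div m) j * restr m b j s) =
        (\<Sum>j<n + 1. if j = s div m then b ^ (r mod m) * lower_powers c (r div m) j else 0)"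
      using m by (intro sum.cong) (auto simp: restr_div_mod)
    then show ?thesis
      using sn True by (simp add: sum.delta')
  next
    case False
    then have "(\<Sum>j<n + 1. b ^ (r mod m) * lower_powers c (r div m) j * restr m b j s) =
        (\<Sum>j<n + 1. if j = s div m + 1
          then b ^ (r mod m) * lower_powers c (r div m) j * b ^ (m - s mod m) else 0)"
      using m by (intro sum.cong) (auto simp: restr_div_mod)
    then show ?thesis
      using sn'[OF False] False by (simp add: sum.delta')
  qed
  have smod: "s mod m < m"
    using m by simp
  show ?thesis
  proof (cases "s mod m = 0")
    case True
    then show ?thesis
      unfolding 1 2 by (auto simp: approx_inv_def F_solve_def lower_powers_def dvd_eq_mod_eq_0)
  next
    case False
    have pw: "b ^ (r mod m + m - s mod m) = b ^ (r mod m) * b ^ (m - s mod m)"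
      using smod by (simp flip: power_add)
    \<comment> \<open>That \<open>r\<close> is an F-point follows from
      \<open>0 < s mod m \<le> r mod m\<close>.\<close>
    have F: "F_solve m b r s = (if r div m = s div m \<and> s mod m \<le> r mod m
        then b ^ (r mod m - s mod m) else 0)"
    proof (cases "r div m = s div m")
      case eq: True
      have "r = s div m * m + r mod m" "s = s div m * m + s mod m"
        using eq by (metis div_mult_mod_eq)+
      then have "s \<le> r \<longleftrightarrow> s mod m \<le> r mod m" "r - s = r mod m - s mod m"
        by linarith+
      then show ?thesis
        using False eq by (auto simp: F_solve_def dvd_eq_mod_eq_0)
    qed (simp add: F_solve_def)
    show ?thesis
      unfolding 1 2 F using False
      by (auto simp: approx_inv_def lower_powers_def pw)
  qed
qed

section \<open>Persymmetry of the matrix \<open>M\<close>\<close>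

lemma approx_inv_split:
  assumes "t < m" and "u < m"
  shows "approx_inv m b c (p * m + t) (q * m + u) =
     (if u = 0 then (if q \<le> p then b ^ t * c ^ (p - q) else 0)
      else if p = q then (if u \<le> t then b ^ (t - u) else 0)
      else if q < p then b ^ (t + m - u) * c ^ (p - q - 1)
      else 0)"
proof -
  have "(p * m + t) div m = p" "(p * m + t) mod m = t" "(q * m + u) div m = q" "(q * m + u) mod m = u"
    using assms by simp_all
  then show ?thesis
    by (simp only: approx_inv_def)
qed

text \<open>Time reversal maps C-points to C-points, and offset \<open>t > 0\<close> in interval
  \<open>p\<close> to offset \<open>m - t\<close> in interval \<open>n - p - 1\<close>. An entry is
  a power of \<open>b\<close> counting fine steps times a power of \<open>c\<close> counting whole
  coarse intervals crossed; reversal with source and target swapped preserves both counts.\<close>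

lemma approx_inv_persymmetric:
  assumes m: "m \<ge> 1" and r: "r \<le> n * m" and s: "s \<le> n * m"
  shows "approx_inv m b c (n * m - s) (n * m - r) = approx_inv m b c r s"
proof -
  define p t q u where "p = r div m" and "t = r mod m" and "q = s div m" and "u = s mod m"
  have rs: "r = p * m + t" "s = q * m + u" and tu: "t < m" "u < m"
    using m by (auto simp: p_def t_def q_def u_def)
  have pn: "p \<le> n" "q \<le> n"
    using r s m unfolding p_def q_def
    by (metis div_le_mono nonzero_mult_div_cancel_right not_one_le_zero)+
  \<comment> \<open>F-points lie in the intervals \<open>0\<close> to \<open>n - 1\<close>; hence
    \<open>n - p - 1\<close> and, likewise, \<open>n - q - 1\<close> are not truncated.\<close>
  have pn': "p < n" if "t > 0"
  proof -
    have "p * m < n * m" using r rs that by linarith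
    then show ?thesis by simp
  qed
  have qn': "q < n" if "u > 0"
  proof -
    have "q * m < n * m" using s rs that by linarith
    then show ?thesis by simp
  qed
  have s': "n * m - s = (if u = 0 then (n - q) * m + 0 else (n - q - 1) * m + (m - u))"
    using tu qn' by (auto simp: rs diff_mult_distrib)
      (metis (no_types, lifting) Suc_diff_Suc add_diff_assoc2 diff_diff_left less_imp_le_nat mult_Suc add.commute diff_mult_distrib)
  have r': "n * m - r = (if t = 0 then (n - p) * m + 0 else (n - p - 1) * m + (m - t))"
    using tu pn' by (auto simp: rs diff_mult_distrib)
      (metis (no_types, lifting) Suc_diff_Suc add_diff_assoc2 diff_diff_left less_imp_le_nat mult_Suc add.commute diff_mult_distrib)
  show ?thesis
  proof (cases "t = 0")
    case t: True
    show ?thesis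
    proof (cases "u = 0")
      case u: True
      have "(n - q) - (n - p) = p - q" "n - p \<le> n - q \<longleftrightarrow> q \<le> p"
        using pn by auto
      with t u show ?thesis
        using tu approx_inv_split[of 0 m 0 b c "n - q" "n - p"] approx_inv_split[of 0 m 0 b c p q]
        unfolding s' r' by (simp add: rs)
    next
      case u: False
      have "(n - q - 1) - (n - p) = p - q - 1" "n - p \<le> n - q - 1 \<longleftrightarrow> q < p"
        using pn qn' u by auto
      with t u show ?thesis
        using tu approx_inv_split[of "m - u" m 0 b c "n - q - 1" "n - p"]
          approx_inv_split[of 0 m u b c p q]
        unfolding s' r' by (simp add: rs)
    qed
  next
    case t: False
    show ?thesis
    proof (cases "u = 0")
      case u: True
      have "(n - q) - (n - p - 1) - 1 = p - q" "n - p - 1 < n - q \<longleftrightarrow> q \<le> p"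
        "n - q \<noteq> n - p - 1 \<or> \<not> q \<le> p"
        using pn pn' t by auto
      with t u show ?thesis
        using tu approx_inv_split[of 0 m "m - t" b c "n - q" "n - p - 1"]
          approx_inv_split[of t m 0 b c p q]
        unfolding s' r' by (simp add: rs)
    next
      case u: False
      have "(n - q - 1) - (n - p - 1) - 1 = p - q - 1" "n - p - 1 < n - q - 1 \<longleftrightarrow> q < p"
        "n - q - 1 = n - p - 1 \<longleftrightarrow> p = q" "m - t \<le> m - u \<longleftrightarrow> u \<le> t"
        "m - u - (m - t) = t - u" "m - u + m - (m - t) = t + m - u"
        using pn' qn' t u tu by auto
      with t u show ?thesis
        using tu approx_inv_split[of "m - u" m "m - t" b c "n - q - 1" "n - p - 1"]
          approx_inv_split[of t m u b c p q]
        unfolding s' r' by (simp add: rs)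
    qed
  qed
qed

text \<open>The entries of \<open>I - M B\<close>, where \<open>B\<close> is bidiagonal with \<open>- z\<close> below the diagonal. Column
  \<open>s + 1\<close> is the junk column \<open>n m + 1\<close> if \<open>s\<close> is the last one, but \<open>approx_inv\<close> vanishes there.\<close>

definition err :: "nat \<Rightarrow> complex \<Rightarrow> complex \<Rightarrow> complex \<Rightarrow> nat \<Rightarrow> nat \<Rightarrow> complex" where
  "err m z b c r s =
     (if r = s then 1 else 0) - (approx_inv m b c r s - z * approx_inv m b c r (s + 1))"

lemma approx_inv_beyond:
  assumes "m \<ge> 1" and "r \<le> n * m"
  shows "approx_inv m b c r (n * m + 1) = 0"
\<comment> \<open>For \<open>m = 1\<close> the junk column is a C-point of index
  \<open>n + 1\<close>. Otherwise it has offset 1 in interval \<open>n\<close>, whose only row has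
  offset 0.\<close>
proof (cases "m = 1")
  case True
  with assms show ?thesis by (simp add: approx_inv_def)
next
  case False
  then have m: "1 < m" using assms by simp
  have "r div m < n \<or> r div m = n \<and> r mod m = 0"
    using assms m by (metis div_le_mono le_neq_implies_less nonzero_mult_div_cancel_right not_one_le_zero add_cancel_right_right div_mult_mod_eq le_add1 order_antisym)
  then show ?thesis
    using approx_inv_split[of "r mod m" m 1 b c "r div m" n] m by auto
qed

lemma err_eq_sum:
  assumes "m \<ge> 1" and "r < n * m + 1" and "s < n * m + 1"
  shows "(if r = s then 1 else 0) - (\<Sum>l<n * m + 1. approx_inv m b c r l * bidiag z l s) =
    err m z b c r s"
proof (cases "s = n * m")
  case True
  then show ?thesis
    using approx_inv_beyond[of m r n b c] assms
    unfolding bidiag_mult_right[OF assms(3)] by (simp add: err_def)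
next
  case False
  then show ?thesis
    using assms unfolding bidiag_mult_right[OF assms(3)] by (simp add: err_def)
qed

text \<open>Persymmetry of \<open>M\<close> turns the predecessor row in \<open>B M\<close> into the
  successor column in \<open>M B\<close>.\<close>

lemma err_persymmetric:
  assumes m: "m \<ge> 1" and r: "r < n * m + 1" and s: "s < n * m + 1"
  shows "(if r = s then 1 else 0) - (\<Sum>l<n * m + 1. bidiag z r l * approx_inv m b c l s) =
    err m z b c (n * m - s) (n * m - r)"
proof -
  have 1: "approx_inv m b c (n * m - s) (n * m - r) = approx_inv m b c r s"
    using assms by (intro approx_inv_persymmetric) auto
  \<comment> \<open>Row 0 has no predecessor; its reflection would use the junk column
    \<open>n * m + 1\<close>, which is zero.\<close>
  have 2: "approx_inv m b c (n * m - s) (n * m - r + 1) = (if r = 0 then 0 else approx_inv m b c (r - 1) s)"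
  proof (cases "r = 0")
    case True
    then show ?thesis
      using approx_inv_beyond[of m "n * m - s" n b c] m by simp
  next
    case False
    then have "n * m - r + 1 = n * m - (r - 1)"
      using r by simp
    then show ?thesis
      using False assms approx_inv_persymmetric[of m "r - 1" n s b c] by simp
  qed
  have "n * m - s = n * m - r \<longleftrightarrow> r = s"
    using r s by auto
  then show ?thesis
    unfolding bidiag_mult_left[OF r] err_def 1 2 by simp
qed

text \<open>Off the diagonal, an entry compares \<open>M\<close> from \<open>s\<close> to
  \<open>r\<close> with one step \<open>z\<close> followed by \<open>M\<close> from
  \<open>s + 1\<close> to \<open>r\<close>. Inside an interval or from an F-point only the first
  step differs, \<open>b\<close> against \<open>z\<close>. From a C-point to a later interval,
  \<open>c\<close> competes with \<open>z * b ^ (m - 1)\<close>.\<close>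

lemma err_split:
  assumes t: "t < m" and u: "u < m"
  shows "err m z b c (p * m + t) (q * m + u) =
     (if p = q then (if u < t then - (b ^ (t - u - 1) * (b - z)) else 0)
      else if q < p then
        - (b ^ t * c ^ (p - q - 1) * (if u = 0 then c - z * b ^ (m - 1) else b ^ (m - u - 1) * (b - z)))
      else 0)"
proof -
  have eq: "p * m + t = q * m + u \<longleftrightarrow> p = q \<and> t = u"
    using t u by (metis div_mult_self3 add.commute add_left_cancel div_less add_0 not_less_zero)
  have pw: "x ^ k = x * x ^ (k - 1)" if "k > 0" for x :: complex and k
    using that by (cases k) auto
  \<comment> \<open>The successor column lies in the same interval exactly if
    \<open>u + 1 < m\<close>; otherwise it is the C-point opening interval
    \<open>q + 1\<close>.\<close>
  show ?thesis
  proof (cases "u + 1 < m")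
    case True
    then have next_col: "approx_inv m b c (p * m + t) (q * m + u + 1) =
       (if p = q then (if u < t then b ^ (t - u - 1) else 0)
      else if q < p then b ^ (t + m - u - 1) * c ^ (p - q - 1)
      else 0)"
      using approx_inv_split[of t m "u + 1" b c p q] t by (auto simp: Suc_le_eq)
    consider "p = q" "u < t" | "p = q" "u \<ge> t" | "q < p" "u = 0" | "q < p" "u > 0" | "p < q"
      by linarith
    then show ?thesis
    proof cases
      case 1
      then show ?thesis
        unfolding err_def next_col approx_inv_split[OF t u] eq
        using pw[of "t - u" b] pw[of t b] by (auto simp: algebra_simps)
    next
      case 3
      have "b ^ (t + m - 1) = b ^ t * b ^ (m - 1)"
        using True by (simp flip: power_add)
      with 3 show ?thesis
        unfolding err_def next_col approx_inv_split[OF t u] eq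
        using pw[of "p - q" c] by (simp add: algebra_simps)
    next
      case 4
      have "b ^ (t + m - u) = b ^ t * (b * b ^ (m - u - 1))" "b ^ (t + m - u - 1) = b ^ t * b ^ (m - u - 1)"
        using True by (simp_all add: Suc_diff_Suc flip: power_add power_Suc)
      with 4 show ?thesis
        unfolding err_def next_col approx_inv_split[OF t u] eq
        by (simp add: algebra_simps)
    qed (unfold err_def next_col approx_inv_split[OF t u] eq, auto)
  next
    case False
    then have um: "m = u + 1"
      using u by simp
    have next_col: "approx_inv m b c (p * m + t) (q * m + u + 1) =
       (if q < p then b ^ t * c ^ (p - q - 1) else 0)"
      using approx_inv_split[of t m 0 b c p "q + 1"] t um by (auto simp: algebra_simps)
    consider "p = q" | "q < p" "u = 0" | "q < p" "u > 0" | "p < q"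
      by linarith
    then show ?thesis
    proof cases
      case 1
      then show ?thesis
        unfolding err_def next_col approx_inv_split[OF t u] eq
        using t um by auto
    next
      case 2
      then show ?thesis
        unfolding err_def next_col approx_inv_split[OF t u] eq
        using pw[of "p - q" c] t um by (simp add: algebra_simps)
    next
      case 3
      then show ?thesis
        unfolding err_def next_col approx_inv_split[OF t u] eq
        using t um by (simp add: algebra_simps)
    qed (unfold err_def next_col approx_inv_split[OF t u] eq, auto)
  qed
qed

section \<open>The operators as matrices\<close>

lemma sum_select:
  fixes g :: "nat \<Rightarrow> 'a :: semiring_1"
  assumes "x < n"
  shows "(\<Sum>l<n. (if l = x then 1 else 0) * g l) = g x"
    and "(\<Sum>l<n. g l * (if l = x then 1 else 0)) = g x"
proof -
  have "(if l = x then 1 else 0) * g l = (if l = x then g l else 0)"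
    and "g l * (if l = x then 1 else 0) = (if l = x then g l else 0)" for l
    by auto
  with assms show "(\<Sum>l<n. (if l = x then 1 else 0) * g l) = g x"
    and "(\<Sum>l<n. g l * (if l = x then 1 else 0)) = g x"
    by simp_all
qed

lemma sum_select_nth:
  fixes g :: "nat \<Rightarrow> 'a :: semiring_1"
  assumes "distinct F"
  shows "(\<Sum>i<length F. (if r = F ! i then 1 else 0) * g (F ! i)) = (if r \<in> set F then g r else 0)"
proof -
  have "(\<Sum>i<length F. (if r = F ! i then 1 else 0) * g (F ! i)) =
      (\<Sum>x\<in>set F. (if r = x then 1 else 0) * g x)"
    using bij_betw_nth[OF assms, of "{..<length F}" "set F"]
    by (intro sum.reindex_bij_betw[where h = "\<lambda>i. F ! i" and g = "\<lambda>x. (if r = x then 1 else 0) * g x"]) simp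
  also have "\<dots> = (\<Sum>x\<in>set F. if r = x then g x else 0)"
    by (intro sum.cong) auto
  finally show ?thesis
    by simp
qed

lemma set_F_points1: "set (F_points1 m N) = {i. i < N 1 \<and> \<not> m 1 dvd i}"
  and distinct_F_points1: "distinct (F_points1 m N)"
  by (auto simp: F_points1_def)

lemma minv_A_op: "minv (A_op Nx N lam l) = diag_blocks Nx (N l) (N l) (\<lambda>k. lower_powers (lam l k))"
proof -
  have "A_op Nx N lam l * diag_blocks Nx (N l) (N l) (\<lambda>k. lower_powers (lam l k)) = 1\<^sub>m (N l * Nx)"
    unfolding A_op_diag diag_blocks_mult one_mat_diag_blocks
    by (rule diag_blocks_cong) (simp add: bidiag_lower_powers)
  then show ?thesis
    using mat_inverse_eqI[of "A_op Nx N lam l" "N l * Nx"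
        "diag_blocks Nx (N l) (N l) (\<lambda>k. lower_powers (lam l k))"]
    by (simp add: A_op_diag)
qed

text \<open>The inverse of the FF-block is \<open>F_solve\<close> sampled at the F-points.
  Multiplying by \<open>S1_op\<close> on both sides extends it by zero, and \<open>F_solve\<close>
  already vanishes at C-points.\<close>

lemma F_relaxation_diag:
  "S1_op Nx m N * minv (transpose_mat (S1_op Nx m N) * A_op Nx N lam 1 * S1_op Nx m N) *
     transpose_mat (S1_op Nx m N) = diag_blocks Nx (N 1) (N 1) (\<lambda>k. F_solve (m 1) (lam 1 k))"
proof -
  define F where "F = F_points1 m N"
  have dist: "distinct F" and setF: "set F = {i. i < N 1 \<and> \<not> m 1 dvd i}"
    unfolding F_def by (rule distinct_F_points1 set_F_points1)+
  have Fi: "F ! i < N 1" "\<not> m 1 dvd F ! i" if "i < length F" for i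
    using nth_mem[OF that] unfolding setF by auto
  define X where "X = diag_blocks Nx (length F) (length F)
    (\<lambda>k i j. F_solve (m 1) (lam 1 k) (F ! i) (F ! j))"
  have A_FF: "transpose_mat (S1_op Nx m N) * A_op Nx N lam 1 * S1_op Nx m N =
      diag_blocks Nx (length F) (length F) (\<lambda>k i j. bidiag (lam 1 k) (F ! i) (F ! j))"
    unfolding S1_op_diag F_def[symmetric] A_op_diag diag_blocks_transpose diag_blocks_mult
    by (rule diag_blocks_cong) (simp add: sum_select Fi[unfolded One_nat_def])
  have "diag_blocks Nx (length F) (length F) (\<lambda>k i j. bidiag (lam 1 k) (F ! i) (F ! j)) * X =
      1\<^sub>m (length F * Nx)"
    unfolding X_def diag_blocks_mult one_mat_diag_blocks
  proof (rule diag_blocks_cong)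
    fix k i j
    assume i: "i < length F" and j: "j < length F"
    let ?g = "\<lambda>l. bidiag (lam 1 k) (F ! i) l * F_solve (m 1) (lam 1 k) l (F ! j)"
    have "(\<Sum>l<length F. ?g (F ! l)) = (\<Sum>l\<in>set F. ?g l)"
      using bij_betw_nth[OF dist, of "{..<length F}" "set F"]
      by (intro sum.reindex_bij_betw[where h = "\<lambda>i. F ! i" and g = ?g]) simp
    \<comment> \<open>Adding the C-points costs nothing since \<open>F_solve\<close> is zero there,
      and it makes \<open>bidiag_F_solve\<close> applicable.\<close>
    also have "\<dots> = (\<Sum>l<N 1. ?g l)"
      unfolding setF by (intro sum.mono_neutral_left) (auto simp: F_solve_def)
    also have "\<dots> = (if F ! i = F ! j then 1 else 0)"
      using Fi[OF i] Fi[OF j] by (simp add: bidiag_F_solve)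
    also have "\<dots> = (if i = j then 1 else 0)"
      using dist i j by (simp add: nth_eq_iff_index_eq)
    finally show "(\<Sum>l<length F. ?g (F ! l)) = (if i = j then 1 else 0)" .
  qed
  then have minv: "minv (transpose_mat (S1_op Nx m N) * A_op Nx N lam 1 * S1_op Nx m N) = X"
    unfolding A_FF
    using mat_inverse_eqI[of
        "diag_blocks Nx (length F) (length F) (\<lambda>k i j. bidiag (lam 1 k) (F ! i) (F ! j))"
        "length F * Nx" X]
    by (simp add: X_def)
  show ?thesis
    unfolding minv unfolding X_def S1_op_diag F_def[symmetric] diag_blocks_transpose diag_blocks_mult
  proof (rule diag_blocks_cong)
    fix k r s
    assume r: "r < N 1" and s: "s < N 1"
    let ?a = "\<lambda>r s. F_solve (m 1) (lam 1 k) r s"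
    have "(\<Sum>j<length F. (\<Sum>i<length F. (if r = F ! i then 1 else 0) * ?a (F ! i) (F ! j)) *
          (if s = F ! j then 1 else 0)) =
        (\<Sum>j<length F. (if s = F ! j then 1 else 0) * (if r \<in> set F then ?a r (F ! j) else 0))"
      by (simp only: sum_select_nth[OF dist, of r "\<lambda>x. ?a x _"] mult.commute)
    also have "\<dots> = (if s \<in> set F then if r \<in> set F then ?a r s else 0 else 0)"
      by (rule sum_select_nth[OF dist, of s "\<lambda>x. if r \<in> set F then ?a r x else 0"])
    also have "\<dots> = ?a r s"
      using r s by (auto simp: setF F_solve_def)
    finally show "(\<Sum>j<length F. (\<Sum>i<length F. (if r = F ! i then 1 else 0) * ?a (F ! i) (F ! j)) *
          (if s = F ! j then 1 else 0)) = ?a r s" .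
  qed
qed

section \<open>Transfer between levels 0 and 1\<close>

lemma RI0_P_op:
  assumes m: "m 0 \<ge> 1" and N0: "N 0 = (N 1 - 1) * m 0 + 1"
  shows "RI0_op Nx m N * P_op Nx m N lam 0 = 1\<^sub>m (N 1 * Nx)"
  unfolding RI0_op_diag P_op_diag One_nat_def[symmetric] diag_blocks_mult one_mat_diag_blocks
proof (rule diag_blocks_cong)
  fix k i j
  assume i: "i < N 1"
  have "i * m 0 < N 0"
    using i by (auto simp: N0 less_Suc_eq_le)
  then show "(\<Sum>l<N 0. (if l = i * m 0 then 1 else 0) * prolong (m 0) (lam 0 k) l j) =
      (if i = j then 1 else 0)"
    using m by (auto simp: sum_select prolong_div_mod)
qed

lemma R_RI0_transpose:
  assumes m: "m 0 \<ge> 1" and N0: "N 0 = (N 1 - 1) * m 0 + 1"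
  shows "R_op Nx m N lam 0 * transpose_mat (RI0_op Nx m N) = 1\<^sub>m (N 1 * Nx)"
  unfolding RI0_op_diag R_op_diag One_nat_def[symmetric] diag_blocks_transpose diag_blocks_mult
    one_mat_diag_blocks
proof (rule diag_blocks_cong)
  fix k i j
  assume j: "j < N 1"
  have "j * m 0 < N 0"
    using j by (auto simp: N0 less_Suc_eq_le)
  then show "(\<Sum>l<N 0. restr (m 0) (lam 0 k) i l * (if l = j * m 0 then 1 else 0)) =
      (if i = j then 1 else 0)"
    using m by (simp add: sum_select restr_C_point)
qed

text \<open>By \<open>bidiag_prolong\<close>, column \<open>j\<close> is supported on the C-points
  \<open>j\<close> and \<open>j + 1\<close>, with the values of column \<open>j\<close> of the
  coarse bidiagonal matrix.\<close>

lemma A_P_op: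
  assumes m: "m 0 \<ge> 1" and N0: "N 0 = (N 1 - 1) * m 0 + 1"
  shows "A_op Nx N lam 0 * P_op Nx m N lam 0 =
    transpose_mat (RI0_op Nx m N) * diag_blocks Nx (N 1) (N 1) (\<lambda>k. bidiag (lam 0 k ^ m 0))"
  unfolding RI0_op_diag A_op_diag P_op_diag One_nat_def[symmetric] diag_blocks_transpose
    diag_blocks_mult
proof (rule diag_blocks_cong)
  fix k x j
  let ?z = "lam 0 k"
  assume x: "x < N 0" and j: "j < N 1"
  have "(\<Sum>i<N 1. (if x = i * m 0 then 1 else 0) * bidiag (?z ^ m 0) i j) =
    (if x = j * m 0 then 1 else 0) - (if x = (j + 1) * m 0 then ?z ^ m 0 else 0)"
  proof (cases "m 0 dvd x")
    case True
    then obtain i where i: "x = i * m 0"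
      by (metis dvd_div_mult_self)
    then have "i * m 0 \<le> (N 1 - 1) * m 0"
      using x unfolding N0 by linarith
    then have "i < N 1"
      using m j by auto
    moreover have eq: "x = i' * m 0 \<longleftrightarrow> i' = i" for i'
      using i m by auto
    ultimately have "(\<Sum>i<N 1. (if x = i * m 0 then 1 else 0) * bidiag (?z ^ m 0) i j) =
        bidiag (?z ^ m 0) i j"
      by (simp only: sum_select)
    then show ?thesis
      unfolding eq by (simp add: bidiag_def)
  next
    case False
    then have "x \<noteq> i * m 0" for i
      by auto
    from this[of j] this[of "j + 1"] this show ?thesis by simp
  qed
  then show "(\<Sum>l<N 0. bidiag ?z x l * prolong (m 0) ?z l j) =
      (\<Sum>i<N 1. (if x = i * m 0 then 1 else 0) * bidiag (?z ^ m 0) i j)"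
    using bidiag_prolong[OF m x, of ?z j] by simp
qed

text \<open>\<open>A_P_op\<close> leaves a vector supported on C-points, which the restriction
  simply reads off.\<close>

lemma R_A_P_op:
  assumes m: "m 0 \<ge> 1" and N0: "N 0 = (N 1 - 1) * m 0 + 1"
  shows "R_op Nx m N lam 0 * A_op Nx N lam 0 * P_op Nx m N lam 0 =
    diag_blocks Nx (N 1) (N 1) (\<lambda>k. bidiag (lam 0 k ^ m 0))" (is "_ = ?B")
proof -
  have carriers: "R_op Nx m N lam 0 \<in> carrier_mat (N 1 * Nx) (N 0 * Nx)"
    "A_op Nx N lam 0 \<in> carrier_mat (N 0 * Nx) (N 0 * Nx)"
    "P_op Nx m N lam 0 \<in> carrier_mat (N 0 * Nx) (N 1 * Nx)"
    "transpose_mat (RI0_op Nx m N) \<in> carrier_mat (N 0 * Nx) (N 1 * Nx)"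
    "?B \<in> carrier_mat (N 1 * Nx) (N 1 * Nx)"
    by (simp_all add: R_op_diag A_op_diag P_op_diag RI0_op_diag)
  have "R_op Nx m N lam 0 * A_op Nx N lam 0 * P_op Nx m N lam 0 =
      R_op Nx m N lam 0 * (transpose_mat (RI0_op Nx m N) * ?B)"
    using assoc_mult_mat[OF carriers(1-3)] A_P_op[where m = m and N = N, OF assms] by simp
  also have "\<dots> = ?B"
    using assoc_mult_mat[OF carriers(1,4,5)] R_RI0_transpose[where m = m and N = N, OF assms, of Nx lam] carriers(5)
    by simp
  finally show ?thesis .
qed

section \<open>The level-1 error propagator and the propagator of residuals\<close>

lemma E_Delta_eq:
  assumes m: "m 0 \<ge> 1" "m 1 \<ge> 1"
    and N: "N 2 = n + 1" "N 1 = n * m 1 + 1" "N 0 = (N 1 - 1) * m 0 + 1"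
  shows "E_Delta Nx m N lam = 1\<^sub>m (N 1 * Nx) -
    diag_blocks Nx (N 1) (N 1) (\<lambda>k. approx_inv (m 1) (lam 1 k) (lam 2 k)) *
    diag_blocks Nx (N 1) (N 1) (\<lambda>k. bidiag (lam 0 k ^ m 0))"
proof -
  have "P_op Nx m N lam 1 * minv (A_op Nx N lam 2) * R_op Nx m N lam 1 +
      diag_blocks Nx (N 1) (N 1) (\<lambda>k. F_solve (m 1) (lam 1 k)) =
      diag_blocks Nx (N 1) (N 1) (\<lambda>k. approx_inv (m 1) (lam 1 k) (lam 2 k))"
    unfolding minv_A_op unfolding P_op_diag R_op_diag Suc_1 diag_blocks_mult diag_blocks_add
    by (rule diag_blocks_cong)
      (simp only: N coarse_correction[OF m(2)])
  then show ?thesis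
    unfolding E_Delta_def F_relaxation_diag R_A_P_op[where m = m and N = N, OF m(1) N(3)] by simp
qed

lemma E_Delta_diag:
  assumes m: "m 0 \<ge> 1" "m 1 \<ge> 1"
    and N: "N 2 = n + 1" "N 1 = n * m 1 + 1" "N 0 = (N 1 - 1) * m 0 + 1"
  shows "E_Delta Nx m N lam =
    diag_blocks Nx (N 1) (N 1) (\<lambda>k. err (m 1) (lam 0 k ^ m 0) (lam 1 k) (lam 2 k))"
  unfolding E_Delta_eq[OF assms] diag_blocks_mult one_mat_diag_blocks diag_blocks_minus
  by (rule diag_blocks_cong) (simp only: N(2) err_eq_sum[OF m(2)])

text \<open>Both sides are \<open>B - B M B\<close>, because \<open>G = I - B M\<close> by
  \<open>err_persymmetric\<close>.\<close>

lemma residual_propagation: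
  fixes lam :: "nat \<Rightarrow> nat \<Rightarrow> complex" and Nx :: nat
  assumes m: "m 0 \<ge> 1" "m 1 \<ge> 1"
    and N: "N 2 = n + 1" "N 1 = n * m 1 + 1" "N 0 = (N 1 - 1) * m 0 + 1"
  defines "B \<equiv> diag_blocks Nx (N 1) (N 1) (\<lambda>k. bidiag (lam 0 k ^ m 0))"
    and "G \<equiv> diag_blocks Nx (N 1) (N 1) (\<lambda>k r s.
      err (m 1) (lam 0 k ^ m 0) (lam 1 k) (lam 2 k) (n * m 1 - s) (n * m 1 - r))"
  shows "B * E_Delta Nx m N lam = G * B"
proof -
  define M where "M = diag_blocks Nx (N 1) (N 1) (\<lambda>k. approx_inv (m 1) (lam 1 k) (lam 2 k))"
  have carriers: "B \<in> carrier_mat (N 1 * Nx) (N 1 * Nx)" "M \<in> carrier_mat (N 1 * Nx) (N 1 * Nx)"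
    by (simp_all add: B_def M_def)
  have G: "G = 1\<^sub>m (N 1 * Nx) - B * M"
    unfolding G_def B_def M_def diag_blocks_mult one_mat_diag_blocks diag_blocks_minus
    by (rule diag_blocks_cong) (simp only: N(2) err_persymmetric[OF m(2)])
  have "B * (1\<^sub>m (N 1 * Nx) - M * B) = B - B * (M * B)"
    using mult_minus_distrib_mat[OF carriers(1) one_carrier_mat mult_carrier_mat[OF carriers(2,1)]]
    unfolding right_mult_one_mat[OF carriers(1)] .
  also have "\<dots> = (1\<^sub>m (N 1 * Nx) - B * M) * B"
    using minus_mult_distrib_mat[OF one_carrier_mat mult_carrier_mat[OF carriers(1,2)] carriers(1)]
    unfolding left_mult_one_mat[OF carriers(1)] assoc_mult_mat[OF carriers(1,2,1)] by simp
  finally show ?thesis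
    unfolding G E_Delta_eq[OF m N] by (simp add: B_def M_def)
qed

section \<open>Norms\<close>

lemma mult_mat_vec_diag_blocks:
  assumes "w \<in> carrier_vec (nc * Nx)" and "r < nr" and "k < Nx"
  shows "(diag_blocks Nx nr nc f *\<^sub>v w) $ (r * Nx + k) = (\<Sum>c<nc. f k r c * w $ (c * Nx + k))"
proof -
  have "(diag_blocks Nx nr nc f *\<^sub>v w) $ (r * Nx + k) =
      (\<Sum>j<nc * Nx. diag_blocks Nx nr nc f $$ (r * Nx + k, j) * w $ j)"
    using assms by (simp add: scalar_prod_def lessThan_atLeast0 block_less)
  also have "\<dots> = (\<Sum>c<nc. \<Sum>l<Nx. if l = k then f k r c * w $ (c * Nx + k) else 0)"
    unfolding sum_blocks using assms by (intro sum.cong refl) (auto simp: diag_blocks_index')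
  also have "\<dots> = (\<Sum>c<nc. f k r c * w $ (c * Nx + k))"
    using assms(3) by simp
  finally show ?thesis .
qed

text \<open>Sorts scalar indices by their offset \<open>k\<close> in a block, so that a maximum over
  all columns splits into the columns of the matrices \<open>f k\<close>.\<close>

lemma lessThan_mult_image: "{..<n * Nx} = (\<Union>k<Nx. (\<lambda>c. c * Nx + k) ` {..<n :: nat})"
proof (intro equalityI subsetI)
  fix i
  assume "i \<in> {..<n * Nx}"
  then have "i mod Nx < Nx" "i div Nx < n"
    by (auto intro: mod_less_block div_less_block)
  then show "i \<in> (\<Union>k<Nx. (\<lambda>c. c * Nx + k) ` {..<n})"
    by (intro UN_I[of "i mod Nx"] image_eqI[of _ _ "i div Nx"]) auto
qed (auto simp: block_less)

lemma mat_norm_1_diag_blocks: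
  "mat_norm_1 (diag_blocks Nx nr nc f) = Max (\<Union>k<Nx. (\<lambda>c. \<Sum>r<nr. cmod (f k r c)) ` {..<nc})"
proof -
  have "(\<Sum>i<nr * Nx. cmod (diag_blocks Nx nr nc f $$ (i, c * Nx + k))) = (\<Sum>r<nr. cmod (f k r c))"
    if "k < Nx" "c < nc" for k c
  proof -
    have "(\<Sum>i<nr * Nx. cmod (diag_blocks Nx nr nc f $$ (i, c * Nx + k))) =
        (\<Sum>r<nr. \<Sum>l<Nx. if l = k then cmod (f k r c) else 0)"
      unfolding sum_blocks using that by (intro sum.cong refl) (auto simp: diag_blocks_index')
    then show ?thesis using that by simp
  qed
  then show ?thesis
    unfolding mat_norm_1_def dim_row_diag_blocks dim_col_diag_blocks lessThan_mult_image[of nc]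
      image_UN image_image
    by (intro arg_cong[of _ _ Max] SUP_cong image_cong) auto
qed

lemma mat_norm_inf_diag_blocks:
  "mat_norm_inf (diag_blocks Nx nr nc f) = Max (\<Union>k<Nx. (\<lambda>r. \<Sum>c<nc. cmod (f k r c)) ` {..<nr})"
proof -
  have "mat_norm_inf (diag_blocks Nx nr nc f) = mat_norm_1 (transpose_mat (diag_blocks Nx nr nc f))"
    unfolding mat_norm_inf_def mat_norm_1_def
    by (intro arg_cong[of _ _ Max] image_cong) (auto intro!: sum.cong)
  then show ?thesis
    by (simp add: diag_blocks_transpose mat_norm_1_diag_blocks)
qed

text \<open>Column \<open>c\<close> of the reflected matrix is row \<open>L - c\<close> of the
  original read backwards.\<close>

lemma sum_abs_transpose_reverse:
  "(\<lambda>c. \<Sum>r<L + 1. g (L - c) (L - r)) ` {..<L + 1} = (\<lambda>r. \<Sum>c<L + 1. g r c) ` {..<L + 1 :: nat}"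
  for g :: "nat \<Rightarrow> nat \<Rightarrow> real"
proof -
  have "(\<Sum>r<L + 1. g (L - c) (L - r)) = (\<Sum>c'<L + 1. g (L - c) c')" for c
    using sum.nat_diff_reindex[of "g (L - c)" "L + 1"] by simp
  then have "(\<lambda>c. \<Sum>r<L + 1. g (L - c) (L - r)) ` {..<L + 1} =
      (\<lambda>r. \<Sum>c<L + 1. g r c) ` (\<lambda>c. L - c) ` {..<L + 1}"
    by (simp only: image_image)
  moreover have "i \<in> (\<lambda>c. L - c) ` {..<L + 1}" if "i < L + 1" for i
    using that by (intro image_eqI[of _ _ "L - i"]) auto
  then have "(\<lambda>c. L - c) ` {..<L + 1} = {..<L + 1}"
    by (intro equalityI subsetI) auto
  ultimately show ?thesis
    by (simp only:)
qed

lemma mat_norm_1_transpose_reverse: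
  "mat_norm_1 (diag_blocks Nx (L + 1) (L + 1) (\<lambda>k r s. f k (L - s) (L - r))) =
     mat_norm_inf (diag_blocks Nx (L + 1) (L + 1) f)"
  unfolding mat_norm_1_diag_blocks mat_norm_inf_diag_blocks
  by (rule arg_cong[of _ _ Max], rule SUP_cong[OF refl])
    (rule sum_abs_transpose_reverse[of "\<lambda>r s. cmod (f _ r s)"])

lemma mat_norm_inf_transpose_reverse:
  "mat_norm_inf (diag_blocks Nx (L + 1) (L + 1) (\<lambda>k r s. f k (L - s) (L - r))) =
     mat_norm_1 (diag_blocks Nx (L + 1) (L + 1) f)"
  unfolding mat_norm_1_diag_blocks mat_norm_inf_diag_blocks
  by (rule arg_cong[of _ _ Max], rule SUP_cong[OF refl])
    (rule sum_abs_transpose_reverse[of "\<lambda>r s. cmod (f _ s r)"])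

text \<open>Cauchy-Schwarz with weights \<open>cmod (G $$ (i, j))\<close> bounds each entry of the
  image at the cost of a row sum; summing over the rows and exchanging the sums produces column
  sums.\<close>

lemma schur_test:
  assumes G: "G \<in> carrier_mat nr nc" and v: "v \<in> carrier_vec nc" and nr: "0 < nr"
  shows "vec_norm_2 (G *\<^sub>v v) \<le> sqrt (mat_norm_1 G * mat_norm_inf G) * vec_norm_2 v"
proof -
  define g where "g i j = cmod (G $$ (i, j))" for i j
  have g0: "g i j \<ge> 0" for i j
    by (simp add: g_def)
  have row: "(\<Sum>j<nc. g i j) \<le> mat_norm_inf G" if "i < nr" for i
    unfolding mat_norm_inf_def using G that by (intro Max_ge) (auto simp: g_def)
  have col: "(\<Sum>i<nr. g i j) \<le> mat_norm_1 G" if "j < nc" for j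
    unfolding mat_norm_1_def using G that by (intro Max_ge) (auto simp: g_def)
  have entry: "(cmod ((G *\<^sub>v v) $ i))\<^sup>2 \<le> mat_norm_inf G * (\<Sum>j<nc. g i j * (cmod (v $ j))\<^sup>2)"
    if i: "i < nr" for i
  proof -
    have "cmod ((G *\<^sub>v v) $ i) = cmod (\<Sum>j<nc. G $$ (i, j) * v $ j)"
      using G v i by (simp add: scalar_prod_def lessThan_atLeast0)
    \<comment> \<open>The weight is split into two square roots, one for each factor of
      Cauchy-Schwarz.\<close>
    also have "\<dots> \<le> (\<Sum>j<nc. \<bar>sqrt (g i j)\<bar> * \<bar>sqrt (g i j) * cmod (v $ j)\<bar>)"
      using g0[of i] by (intro order.trans[OF norm_sum] sum_mono) (simp add: norm_mult g_def abs_mult flip: mult.assoc)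
    also have "\<dots> \<le> L2_set (\<lambda>j. sqrt (g i j)) {..<nc} * L2_set (\<lambda>j. sqrt (g i j) * cmod (v $ j)) {..<nc}"
      by (rule L2_set_mult_ineq)
    finally have "(cmod ((G *\<^sub>v v) $ i))\<^sup>2 \<le>
        (L2_set (\<lambda>j. sqrt (g i j)) {..<nc} * L2_set (\<lambda>j. sqrt (g i j) * cmod (v $ j)) {..<nc})\<^sup>2"
      by (rule power_mono) simp
    also have "\<dots> = (\<Sum>j<nc. g i j) * (\<Sum>j<nc. g i j * (cmod (v $ j))\<^sup>2)"
      using g0 by (simp add: L2_set_def power_mult_distrib sum_nonneg)
    also have "\<dots> \<le> mat_norm_inf G * (\<Sum>j<nc. g i j * (cmod (v $ j))\<^sup>2)"
      using g0 by (intro mult_right_mono row i sum_nonneg) auto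
    finally show ?thesis .
  qed
  \<comment> \<open>Row 0 exists by \<open>nr\<close>; the maximum over an empty set would be
    unspecified.\<close>
  have inf0: "mat_norm_inf G \<ge> 0"
    using row[OF nr] g0 by (meson order.trans sum_nonneg)
  have "(vec_norm_2 (G *\<^sub>v v))\<^sup>2 = (\<Sum>i<nr. (cmod ((G *\<^sub>v v) $ i))\<^sup>2)"
    using G by (simp add: vec_norm_2_def L2_set_def sum_nonneg)
  also have "\<dots> \<le> (\<Sum>i<nr. mat_norm_inf G * (\<Sum>j<nc. g i j * (cmod (v $ j))\<^sup>2))"
    by (intro sum_mono entry) simp
  also have "\<dots> = mat_norm_inf G * (\<Sum>j<nc. (\<Sum>i<nr. g i j) * (cmod (v $ j))\<^sup>2)"
    unfolding sum_distrib_left[symmetric] sum_distrib_right by (subst sum.swap) simp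
  also have "\<dots> \<le> mat_norm_inf G * (\<Sum>j<nc. mat_norm_1 G * (cmod (v $ j))\<^sup>2)"
    by (intro mult_left_mono[OF _ inf0] sum_mono mult_right_mono col) auto
  also have "\<dots> = mat_norm_1 G * mat_norm_inf G * (vec_norm_2 v)\<^sup>2"
    using v by (simp add: vec_norm_2_def L2_set_def sum_nonneg sum_distrib_left mult_ac)
  finally have "sqrt ((vec_norm_2 (G *\<^sub>v v))\<^sup>2) \<le> sqrt (mat_norm_1 G * mat_norm_inf G * (vec_norm_2 v)\<^sup>2)"
    by (rule real_sqrt_le_mono)
  then show ?thesis
    by (simp add: real_sqrt_mult vec_norm_2_def)
qed

lemma vec_norm_2_RI0_transpose:
  assumes m: "m 0 \<ge> 1" and N0: "N 0 = (N 1 - 1) * m 0 + 1"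
    and w: "w \<in> carrier_vec (N 1 * Nx)"
  shows "vec_norm_2 (transpose_mat (RI0_op Nx m N) *\<^sub>v w) = vec_norm_2 w"
proof -
  \<comment> \<open>At most one \<open>c\<close> satisfies \<open>r = c * m 0\<close>, so the
    squared modulus may be taken inside the sum.\<close>
  have entry: "(cmod ((transpose_mat (RI0_op Nx m N) *\<^sub>v w) $ (r * Nx + k)))\<^sup>2 =
      (\<Sum>c<N 1. if r = c * m 0 then (cmod (w $ (c * Nx + k)))\<^sup>2 else 0)"
    if r: "r < N 0" and k: "k < Nx" for r k
  proof -
    have eq: "(transpose_mat (RI0_op Nx m N) *\<^sub>v w) $ (r * Nx + k) =
        (\<Sum>c<N 1. (if r = c * m 0 then 1 else 0) * w $ (c * Nx + k))"
      unfolding RI0_op_diag diag_blocks_transpose by (rule mult_mat_vec_diag_blocks[OF w r k])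
    show ?thesis
    proof (cases "\<exists>c. r = c * m 0")
      case True
      then obtain c where "r = c * m 0" by blast
      with m have "r = c' * m 0 \<longleftrightarrow> c' = c" for c'
        by auto
      then show ?thesis
        unfolding eq by (simp add: if_distrib[of "\<lambda>y. y * _"] cong: if_cong)
    qed (auto simp: eq)
  qed
  have "(\<Sum>i<N 0 * Nx. (cmod ((transpose_mat (RI0_op Nx m N) *\<^sub>v w) $ i))\<^sup>2) =
      (\<Sum>r<N 0. \<Sum>k<Nx. \<Sum>c<N 1. if r = c * m 0 then (cmod (w $ (c * Nx + k)))\<^sup>2 else 0)"
    unfolding sum_blocks by (intro sum.cong refl entry) auto
  also have "\<dots> = (\<Sum>c<N 1. \<Sum>k<Nx. \<Sum>r<N 0. if r = c * m 0 then (cmod (w $ (c * Nx + k)))\<^sup>2 else 0)"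
    by (subst sum.swap[of _ "{..<Nx}" "{..<N 1}"], subst sum.swap,
        rule sum.cong[OF refl], rule sum.swap)
  also have "\<dots> = (\<Sum>c<N 1. \<Sum>k<Nx. (cmod (w $ (c * Nx + k)))\<^sup>2)"
  proof (intro sum.cong refl)
    fix c k
    assume "c \<in> {..<N 1}"
    then have "c * m 0 < N 0"
      by (auto simp: N0 less_Suc_eq_le)
    then show "(\<Sum>r<N 0. if r = c * m 0 then (cmod (w $ (c * Nx + k)))\<^sup>2 else 0) =
        (cmod (w $ (c * Nx + k)))\<^sup>2"
      by simp
  qed
  also have "\<dots> = (\<Sum>i<N 1 * Nx. (cmod (w $ i))\<^sup>2)"
    unfolding sum_blocks ..
  finally show ?thesis
    using w by (simp add: vec_norm_2_def L2_set_def RI0_op_diag)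
qed

section \<open>Row and column sums of the error propagator\<close>

lemma geom_eq_sum: "cmod z < 1 \<Longrightarrow> geom z n = (\<Sum>i<n. cmod z ^ i)"
  by (simp add: geom_def sum_gp_strict)

lemma geom_0 [simp]: "geom z 0 = 0"
  by (simp add: geom_def)

lemma geom_nonneg: "cmod z < 1 \<Longrightarrow> 0 \<le> geom z n"
  by (simp add: geom_eq_sum sum_nonneg)

lemma geom_mono: "cmod z < 1 \<Longrightarrow> k \<le> n \<Longrightarrow> geom z k \<le> geom z n"
  unfolding geom_eq_sum by (intro sum_mono2) auto

text \<open>Serves twice: for offsets inside an interval and for interval indices, since the entries
  depend on distances only. \<open>sum_before\<close> is the counterpart for rows.\<close>

lemma sum_after:
  fixes h :: "nat \<Rightarrow> 'a :: comm_monoid_add"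
  shows "(\<Sum>t<m. if u < t then h (t - u - 1) else 0) = (\<Sum>i<m - u - 1. h i)"
proof -
  have "(\<Sum>t<m. if u < t then h (t - u - 1) else 0) = (\<Sum>t\<in>{u<..<m}. h (t - u - 1))"
    by (rule sum.mono_neutral_cong_right) auto
  also have "\<dots> = (\<Sum>i<m - u - 1. h i)"
    by (rule sum.reindex_bij_witness[of _ "\<lambda>i. i + u + 1" "\<lambda>t. t - u - 1"]) auto
  finally show ?thesis .
qed

lemma sum_before:
  fixes h :: "nat \<Rightarrow> 'a :: comm_monoid_add"
  assumes "t \<le> m"
  shows "(\<Sum>u<m. if u < t then h (t - u - 1) else 0) = (\<Sum>i<t. h i)"
proof -
  have "(\<Sum>u<m. if u < t then h (t - u - 1) else 0) = (\<Sum>u<t. h (t - u - 1))"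
    using assms by (intro sum.mono_neutral_cong_right) auto
  also have "\<dots> = (\<Sum>i<t. h i)"
    using sum.nat_diff_reindex[of h t] by simp
  finally show ?thesis .
qed

text \<open>The rows split into \<open>n\<close> full intervals and the final C-point. The interval
  of the column itself gives the last summand; each later interval \<open>p\<close> gives
  \<open>K * geom b m * cmod c ^ (p - q - 1)\<close>.\<close>

lemma err_col_sum:
  assumes b: "cmod b < 1" and c: "cmod c < 1" and q: "q < n" and u: "u < m"
  shows "(\<Sum>r<n * m + 1. cmod (err m z b c r (q * m + u))) =
    (if u = 0 then cmod (c - z * b ^ (m - 1)) else cmod b ^ (m - u - 1) * cmod (b - z)) *
      (cmod c ^ (n - q - 1) + geom c (n - q - 1) * geom b m) +
    cmod (b - z) * geom b (m - u - 1)"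
proof -
  define K where
    "K = (if u = 0 then cmod (c - z * b ^ (m - 1)) else cmod b ^ (m - u - 1) * cmod (b - z))"
  have block: "(\<Sum>t<m. cmod (err m z b c (p * m + t) (q * m + u))) =
     (if p = q then cmod (b - z) * geom b (m - u - 1) else 0) +
     (if q < p then K * geom b m * cmod c ^ (p - q - 1) else 0)" for p
  proof -
    have "(\<Sum>t<m. cmod (err m z b c (p * m + t) (q * m + u))) =
        (\<Sum>t<m. (if p = q then cmod (b - z) * (if u < t then cmod b ^ (t - u - 1) else 0) else 0) +
          (if q < p then K * cmod c ^ (p - q - 1) * cmod b ^ t else 0))"
      by (intro sum.cong refl, subst err_split[OF _ u])
        (auto simp: K_def norm_mult norm_power mult_ac)
    then show ?thesis
      using sum_after[where m = m and u = u and h = "\<lambda>i. cmod b ^ i"] b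
      by (auto simp: geom_eq_sum simp flip: sum_distrib_left)
  qed
  \<comment> \<open>The final C-point is not followed by F-points, hence no factor
    \<open>geom b m\<close>.\<close>
  have last: "cmod (err m z b c (n * m) (q * m + u)) = cmod c ^ (n - q - 1) * K"
    using q u err_split[of 0 m u z b c n q] by (auto simp: K_def norm_mult norm_power)
  have "(\<Sum>p<n. if q < p then K * geom b m * cmod c ^ (p - q - 1) else 0) =
      K * geom b m * geom c (n - q - 1)"
    using sum_after[where m = n and u = q and h = "\<lambda>i. K * geom b m * cmod c ^ i"] c
    by (simp add: geom_eq_sum sum_distrib_left)
  moreover have "(\<Sum>r<n * m + 1. cmod (err m z b c r (q * m + u))) =
      (\<Sum>p<n. \<Sum>t<m. cmod (err m z b c (p * m + t) (q * m + u))) + cmod c ^ (n - q - 1) * K"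
    by (simp add: sum_blocks last)
  ultimately have "(\<Sum>r<n * m + 1. cmod (err m z b c r (q * m + u))) =
      cmod (b - z) * geom b (m - u - 1) + K * geom b m * geom c (n - q - 1) + cmod c ^ (n - q - 1) * K"
    using q by (simp add: block sum.distrib)
  also have "\<dots> = K * (cmod c ^ (n - q - 1) + geom c (n - q - 1) * geom b m) +
      cmod (b - z) * geom b (m - u - 1)"
    by (simp add: algebra_simps)
  finally show ?thesis
    unfolding K_def .
qed

text \<open>The error propagator is strictly lower triangular.\<close>

lemma err_last_col:
  assumes m: "m \<ge> 1" and "r \<le> n * m"
  shows "err m z b c r (n * m) = 0"
proof -
  have "r div m < n \<or> r div m = n \<and> r mod m = 0"
  proof -
    have "r div m * m + r mod m \<le> n * m"
      using assms by simp
    then have "r div m * m \<le> n * m" "r div m = n \<Longrightarrow> r mod m = 0"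
      by (linarith, simp)
    then show ?thesis
      using m by auto
  qed
  then show ?thesis
    using err_split[of "r mod m" m 0 z b c "r div m" n] m by auto
qed

text \<open>Each earlier interval \<open>q\<close> contributes one C-column and \<open>m - 1\<close>
  F-columns, scaled by \<open>cmod b ^ t * cmod c ^ (p - q - 1)\<close>; the row's own interval
  contributes the first summand.\<close>

lemma err_row_sum:
  assumes b: "cmod b < 1" and c: "cmod c < 1" and t: "t < m" and pt: "p * m + t \<le> n * m"
  shows "(\<Sum>s<n * m + 1. cmod (err m z b c (p * m + t) s)) =
    cmod (b - z) * geom b t +
    cmod b ^ t * geom c p * (cmod (c - z * b ^ (m - 1)) + cmod (b - z) * geom b (m - 1))"
proof -
  define K where "K = cmod b ^ t * (cmod (c - z * b ^ (m - 1)) + cmod (b - z) * geom b (m - 1))"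
  have pn: "p \<le> n"
    using pt t by (metis add_leD1 mult_le_cancel2 not_less0 gr0I)
  have pn': "p < n" if "t > 0"
  proof -
    have "p * m < n * m" using pt that by linarith
    then show ?thesis by simp
  qed
  have block: "(\<Sum>u<m. cmod (err m z b c (p * m + t) (q * m + u))) =
     (if q = p then cmod (b - z) * geom b t else 0) +
     (if q < p then K * cmod c ^ (p - q - 1) else 0)" for q
  proof -
    consider "p = q" | "q < p" | "p < q" by linarith
    then show ?thesis
    proof cases
      case 1
      have "(\<Sum>u<m. cmod (err m z b c (p * m + t) (q * m + u))) =
          (\<Sum>u<m. cmod (b - z) * (if u < t then cmod b ^ (t - u - 1) else 0))"
        using t 1 by (intro sum.cong refl) (auto simp: err_split norm_mult norm_power)
      also have "\<dots> = cmod (b - z) * geom b t"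
        unfolding sum_distrib_left[symmetric] using sum_before[of t m "\<lambda>i. cmod b ^ i"] t b
        by (simp add: geom_eq_sum)
      finally show ?thesis
        using 1 by simp
    next
      case 2
      obtain m' where m': "m = Suc m'"
        using t by (cases m) auto
      have "(\<Sum>u<m. cmod (err m z b c (p * m + t) (q * m + u))) =
          (\<Sum>u<m. cmod b ^ t * cmod c ^ (p - q - 1) *
            (if u = 0 then cmod (c - z * b ^ (m - 1)) else cmod b ^ (m - u - 1) * cmod (b - z)))"
        using t 2 by (intro sum.cong refl) (auto simp: err_split norm_mult norm_power)
      also have "\<dots> = cmod b ^ t * cmod c ^ (p - q - 1) *
          (cmod (c - z * b ^ (m - 1)) + (\<Sum>u<m'. cmod b ^ (m' - Suc u) * cmod (b - z)))"
        unfolding sum_distrib_left[symmetric] unfolding m' sum.lessThan_Suc_shift by simp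
      also have "(\<Sum>u<m'. cmod b ^ (m' - Suc u) * cmod (b - z)) = cmod (b - z) * geom b (m - 1)"
        using sum.nat_diff_reindex[of "\<lambda>i. cmod b ^ i * cmod (b - z)" m'] b
        by (simp add: m' geom_eq_sum sum_distrib_left mult.commute)
      finally show ?thesis
        using 2 by (simp add: K_def mult_ac)
    qed (use t in \<open>auto simp: err_split\<close>)
  qed
  have "err m z b c (p * m + t) (n * m) = 0"
    using t pt by (intro err_last_col) auto
  moreover have "(\<Sum>q<n. if q < p then K * cmod c ^ (p - q - 1) else 0) = K * geom c p"
    using sum_before[of p n "\<lambda>i. K * cmod c ^ i"] c pn
    by (simp add: geom_eq_sum sum_distrib_left)
  \<comment> \<open>The index \<open>p = n\<close> is outside the sum but occurs only for
    \<open>t = 0\<close>, where \<open>geom b t\<close> is zero.\<close>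
  moreover have "(\<Sum>q<n. if q = p then cmod (b - z) * geom b t else 0) = cmod (b - z) * geom b t"
    using pn pn' by (cases "t = 0") auto
  ultimately have "(\<Sum>s<n * m + 1. cmod (err m z b c (p * m + t) s)) =
      cmod (b - z) * geom b t + K * geom c p"
    by (simp add: sum_blocks block sum.distrib)
  then show ?thesis
    by (simp only: K_def mult_ac)
qed

text \<open>Raising the exponent by one replaces \<open>cmod c ^ n\<close> by
  \<open>cmod c ^ n * (cmod c + G)\<close>, and \<open>G \<ge> 1\<close>.\<close>

lemma coarse_weight_mono:
  assumes "cmod c < 1" and G: "1 \<le> G" and "k \<le> n"
  shows "cmod c ^ k + geom c k * G \<le> cmod c ^ n + geom c n * G"
  using assms(3)
proof (induction n rule: dec_induct)
  case (step n)
  have "cmod c ^ n * 1 \<le> cmod c ^ n * (cmod c + G)"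
    using G by (intro mult_left_mono) (auto intro: add_increasing)
  with step.IH show ?case
    using assms(1) by (simp add: geom_eq_sum algebra_simps)
qed simp

text \<open>Lets a few candidate columns or rows stand for all: they occur among the sums and, for
  each \<open>k\<close>, dominate the others.\<close>

lemma Max_UN_eqI:
  fixes X Y :: "nat \<Rightarrow> real set"
  assumes "0 < n" and fin: "\<And>k. k < n \<Longrightarrow> finite (X k)" and ne: "\<And>k. k < n \<Longrightarrow> Y k \<noteq> {}"
    and sub: "\<And>k. k < n \<Longrightarrow> Y k \<subseteq> X k"
    and dom: "\<And>k x. k < n \<Longrightarrow> x \<in> X k \<Longrightarrow> \<exists>y\<in>Y k. x \<le> y"
  shows "Max (\<Union>k<n. X k) = Max (\<Union>k<n. Y k)"
proof (rule antisym)
  have finX: "finite (\<Union>k<n. X k)"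
    using fin by auto
  have YX: "(\<Union>k<n. Y k) \<subseteq> (\<Union>k<n. X k)"
    using sub by blast
  then have finY: "finite (\<Union>k<n. Y k)"
    using finX finite_subset by blast
  have neY: "(\<Union>k<n. Y k) \<noteq> {}"
    using ne \<open>0 < n\<close> by blast
  show "Max (\<Union>k<n. Y k) \<le> Max (\<Union>k<n. X k)"
    by (rule Max_mono[OF YX neY finX])
  show "Max (\<Union>k<n. X k) \<le> Max (\<Union>k<n. Y k)"
  proof (subst Max_le_iff[OF finX])
    show "(\<Union>k<n. X k) \<noteq> {}"
      using YX neY by blast
    show "\<forall>x\<in>\<Union>k<n. X k. x \<le> Max (\<Union>k<n. Y k)"
    proof
      fix x
      assume "x \<in> (\<Union>k<n. X k)"
      then obtain k y where "k < n" "y \<in> Y k" "x \<le> y"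
        using dom by blast
      then show "x \<le> Max (\<Union>k<n. Y k)"
        using Max_ge[OF finY, of y] by (auto intro: order.trans)
    qed
  qed
qed

text \<open>For a fixed offset, the column sum grows with the number of coarse intervals to the
  right, so the first interval dominates.\<close>

lemma mat_norm_1_E_Delta:
  assumes Nx: "Nx \<ge> 1" and m: "m 0 \<ge> 1" "m 1 \<ge> 1" and n: "n \<ge> 1"
    and N: "N 2 = n + 1" "N 1 = n * m 1 + 1" "N 0 = (N 1 - 1) * m 0 + 1"
    and lam: "\<And>l k. l \<le> 2 \<Longrightarrow> k < Nx \<Longrightarrow> cmod (lam l k) < 1"
  shows "mat_norm_1 (E_Delta Nx m N lam) = max_col_sum (\<lambda>j. j - 1) Nx (m 0) (m 1) (N 2) lam"
  unfolding E_Delta_diag[OF m N] mat_norm_1_diag_blocks max_col_sum_def N(1,2)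
proof (rule Max_UN_eqI)
  fix k
  assume k: "k < Nx"
  define z b c where "z = lam 0 k ^ m 0" and "b = lam 1 k" and "c = lam 2 k"
  have b: "cmod b < 1" and c: "cmod c < 1"
    using lam[of 1 k] lam[of 2 k] k by (simp_all add: b_def c_def)
  define f where "f = (\<lambda>s. \<Sum>r<n * m 1 + 1. cmod (err (m 1) z b c r s))"
  define C F where "C = col_C (m 0) (m 1) (n + 1) (lam 0 k) b c"
    and "F = (\<lambda>j. col_F (j - 1) (m 0) (m 1) (n + 1) (lam 0 k) b c j)"
  have f: "f (q * m 1 + u) =
    (if u = 0 then cmod (c - z * b ^ (m 1 - 1)) else cmod b ^ (m 1 - u - 1) * cmod (b - z)) *
      (cmod c ^ (n - q - 1) + geom c (n - q - 1) * geom b (m 1)) +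
    cmod (b - z) * geom b (m 1 - u - 1)" if "q < n" "u < m 1" for q u
    unfolding f_def by (rule err_col_sum[OF b c that])
  have C: "C = f 0"
    using f[of 0 0] n m by (simp add: C_def col_C_def z_def)
  \<comment> \<open>The index \<open>j\<close> counts back from the right end of the interval:
    \<open>j = m 1 - u\<close>, so the exponent \<open>m 1 - u - 1\<close> is
    \<open>j - 1\<close>.\<close>
  have F: "F (m 1 - u) = f u" if "0 < u" "u < m 1" for u
    using f[of 0 u] n that by (simp add: F_def col_F_def z_def)
  have f_mono: "f (q * m 1 + u) \<le> f u" if "q < n" "u < m 1" for q u
  proof -
    have "geom b 1 \<le> geom b (m 1)"
      by (rule geom_mono[OF b m(2)])
    then have "1 \<le> geom b (m 1)"
      using b by (simp add: geom_eq_sum)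
    then have "cmod c ^ (n - q - 1) + geom c (n - q - 1) * geom b (m 1) \<le>
        cmod c ^ (n - 0 - 1) + geom c (n - 0 - 1) * geom b (m 1)"
      by (intro coarse_weight_mono[OF c]) auto
    then show ?thesis
      using f[OF that] f[of 0 u] that n by (auto intro!: mult_left_mono)
  qed
  have "insert C (F ` {1..m 1 - 1}) \<subseteq> f ` {..<n * m 1 + 1}"
  proof -
    have "F j \<in> f ` {..<n * m 1 + 1}" if "j \<in> {1..m 1 - 1}" for j
    proof
      have j: "0 < m 1 - j" "m 1 - j < m 1" "m 1 - (m 1 - j) = j"
        using that by auto
      then show "F j = f (m 1 - j)"
        using F[OF j(1,2)] by simp
      have "m 1 \<le> n * m 1"
        using n by simp
      then have "m 1 - j < n * m 1 + 1"
        by linarith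
      then show "m 1 - j \<in> {..<n * m 1 + 1}"
        by simp
    qed
    then show ?thesis
      using C by auto
  qed
  then show "insert (col_C (m 0) (m 1) (n + 1) (lam 0 k) (lam 1 k) (lam 2 k))
      ((\<lambda>j. col_F (j - 1) (m 0) (m 1) (n + 1) (lam 0 k) (lam 1 k) (lam 2 k) j) ` {1..m 1 - 1})
    \<subseteq> (\<lambda>s. \<Sum>r<n * m 1 + 1. cmod (err (m 1) (lam 0 k ^ m 0) (lam 1 k) (lam 2 k) r s)) `
      {..<n * m 1 + 1}"
    by (simp only: C_def F_def f_def z_def b_def c_def)
  fix x
  assume "x \<in> (\<lambda>s. \<Sum>r<n * m 1 + 1. cmod (err (m 1) (lam 0 k ^ m 0) (lam 1 k) (lam 2 k) r s)) `
      {..<n * m 1 + 1}"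
  then obtain s where s: "s < n * m 1 + 1" and x: "x = f s"
    by (auto simp: f_def z_def b_def c_def)
  have "\<exists>y\<in>insert C (F ` {1..m 1 - 1}). x \<le> y"
  \<comment> \<open>The zero last column is outside the intervals treated by \<open>f_mono\<close>;
    it is dominated by \<open>C\<close>, a sum of moduli.\<close>
  proof (cases "s = n * m 1")
    case True
    then have "x = 0"
      unfolding x f_def using m by (intro sum.neutral) (auto simp: err_last_col)
    moreover have "0 \<le> C"
      unfolding C f_def by (intro sum_nonneg) simp
    ultimately show ?thesis
      by simp
  next
    case False
    define q u where "q = s div m 1" and "u = s mod m 1"
    have su: "s = q * m 1 + u" "u < m 1"
      using m by (simp_all add: q_def u_def)
    then have q: "q < n"
      using s False m by (simp add: q_def less_mult_imp_div_less)
    have "x \<le> f u"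
      using f_mono[OF q su(2)] su(1) x by simp
    moreover have "f u \<in> insert C (F ` {1..m 1 - 1})"
    proof (cases "u = 0")
      case False
      then have "f u = F (m 1 - u)" "m 1 - u \<in> {1..m 1 - 1}"
        using F su(2) by auto
      then show ?thesis by blast
    qed (simp add: C)
    ultimately show ?thesis by blast
  qed
  then show "\<exists>y\<in>insert (col_C (m 0) (m 1) (n + 1) (lam 0 k) (lam 1 k) (lam 2 k))
      ((\<lambda>j. col_F (j - 1) (m 0) (m 1) (n + 1) (lam 0 k) (lam 1 k) (lam 2 k) j) ` {1..m 1 - 1}). x \<le> y"
    by (simp only: C_def F_def b_def c_def)
qed (use Nx in auto)

text \<open>Row sums grow with \<open>p\<close> through \<open>geom c p\<close>. C-rows reach
  \<open>p = n = N 2 - 1\<close>, but F-rows only \<open>p = n - 1 = N 2 - 2\<close>, hence the two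
  exponents.\<close>

lemma mat_norm_inf_E_Delta:
  assumes Nx: "Nx \<ge> 1" and m: "m 0 \<ge> 1" "m 1 \<ge> 1" and n: "n \<ge> 1"
    and N: "N 2 = n + 1" "N 1 = n * m 1 + 1" "N 0 = (N 1 - 1) * m 0 + 1"
    and lam: "\<And>l k. l \<le> 2 \<Longrightarrow> k < Nx \<Longrightarrow> cmod (lam l k) < 1"
  shows "mat_norm_inf (E_Delta Nx m N lam) = max_row_sum Nx (m 0) (m 1) (N 2) lam"
  unfolding E_Delta_diag[OF m N] mat_norm_inf_diag_blocks max_row_sum_def N(1,2)
proof (rule Max_UN_eqI)
  fix k
  assume k: "k < Nx"
  define z b c where "z = lam 0 k ^ m 0" and "b = lam 1 k" and "c = lam 2 k"
  have b: "cmod b < 1" and c: "cmod c < 1"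
    using lam[of 1 k] lam[of 2 k] k by (simp_all add: b_def c_def)
  define f where "f = (\<lambda>r. \<Sum>s<n * m 1 + 1. cmod (err (m 1) z b c r s))"
  define C F where "C = row_C (m 0) (m 1) (n + 1) (lam 0 k) b c"
    and "F = row_F (m 0) (m 1) (n + 1) (lam 0 k) b c"
  have f: "f (p * m 1 + t) =
    cmod (b - z) * geom b t +
    cmod b ^ t * geom c p * (cmod (c - z * b ^ (m 1 - 1)) + cmod (b - z) * geom b (m 1 - 1))"
    if "t < m 1" "p * m 1 + t \<le> n * m 1" for p t
    unfolding f_def by (rule err_row_sum[OF b c that])
  have in_range: "p * m 1 + t \<le> n * m 1" if "p < n" "t < m 1" for p t
    using that block_less[of p n t "m 1"] by simp
  have C: "C = f (n * m 1)"
    using f[of 0 n] m by (simp add: C_def row_C_def z_def algebra_simps)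
  have F: "F t = f ((n - 1) * m 1 + t)" if "t < m 1" for t
    using f[OF that in_range[OF _ that, of "n - 1"]] n
    by (simp add: F_def row_F_def z_def algebra_simps)
  have f_mono: "f (p * m 1 + t) \<le> f (p' * m 1 + t)"
    if "p \<le> p'" "t < m 1" "p' * m 1 + t \<le> n * m 1" for p p' t
  proof -
    have "p * m 1 + t \<le> n * m 1"
      using that by (meson add_le_mono1 le_trans mult_le_mono1)
    then show ?thesis
      using f[of t p] f[of t p'] that geom_mono[OF c that(1)] geom_nonneg[OF b]
      by (auto intro!: mult_right_mono mult_left_mono add_nonneg_nonneg mult_nonneg_nonneg)
  qed
  have "insert C (F ` {1..m 1 - 1}) \<subseteq> f ` {..<n * m 1 + 1}"
  proof -
    have "F j \<in> f ` {..<n * m 1 + 1}" if "j \<in> {1..m 1 - 1}" for j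
    proof
      have j: "j < m 1"
        using that by auto
      then show "F j = f ((n - 1) * m 1 + j)"
        by (rule F)
      show "(n - 1) * m 1 + j \<in> {..<n * m 1 + 1}"
        using in_range[of "n - 1" j] n j by simp
    qed
    then show ?thesis
      using C by auto
  qed
  then show "insert (row_C (m 0) (m 1) (n + 1) (lam 0 k) (lam 1 k) (lam 2 k))
      (row_F (m 0) (m 1) (n + 1) (lam 0 k) (lam 1 k) (lam 2 k) ` {1..m 1 - 1})
    \<subseteq> (\<lambda>r. \<Sum>s<n * m 1 + 1. cmod (err (m 1) (lam 0 k ^ m 0) (lam 1 k) (lam 2 k) r s)) `
      {..<n * m 1 + 1}"
    by (simp only: C_def F_def f_def z_def b_def c_def)
  fix x
  assume "x \<in> (\<lambda>r. \<Sum>s<n * m 1 + 1. cmod (err (m 1) (lam 0 k ^ m 0) (lam 1 k) (lam 2 k) r s)) `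
      {..<n * m 1 + 1}"
  then obtain r where r: "r < n * m 1 + 1" and x: "x = f r"
    by (auto simp: f_def z_def b_def c_def)
  define p t where "p = r div m 1" and "t = r mod m 1"
  have rt: "r = p * m 1 + t" "t < m 1"
    using m by (simp_all add: p_def t_def)
  have "\<exists>y\<in>insert C (F ` {1..m 1 - 1}). x \<le> y"
  proof (cases "t = 0")
    case True
    then have "p * m 1 \<le> n * m 1"
      using r rt by linarith
    then have "p \<le> n"
      using m by simp
    then have "x \<le> C"
      using f_mono[of p n 0] True rt x C by simp
    then show ?thesis by blast
  next
    case False
    then have "p * m 1 < n * m 1"
      using r rt by linarith
    then have "p < n" by simp
    then have "x \<le> F t"
      using f_mono[of p "n - 1" t] in_range[of "n - 1" t] rt x F by simp
    moreover have "t \<in> {1..m 1 - 1}"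
      using False rt by auto
    ultimately show ?thesis by blast
  qed
  then show "\<exists>y\<in>insert (row_C (m 0) (m 1) (n + 1) (lam 0 k) (lam 1 k) (lam 2 k))
      (row_F (m 0) (m 1) (n + 1) (lam 0 k) (lam 1 k) (lam 2 k) ` {1..m 1 - 1}). x \<le> y"
    by (simp only: C_def F_def b_def c_def)
qed (use Nx in auto)

text \<open>Only the last summand of \<open>col_F\<close> involves the exponent, and
  \<open>geom\<close> is monotone in it. This compares the exponents \<open>j - 1\<close> and
  \<open>m1 - 2\<close>.\<close>

lemma max_col_sum_mono:
  assumes "0 < Nx" and lam: "\<And>k. k < Nx \<Longrightarrow> cmod (lam 1 k) < 1"
    and p: "\<And>j. 1 \<le> j \<Longrightarrow> j \<le> m1 - 1 \<Longrightarrow> p j \<le> p' j"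
  shows "max_col_sum p Nx m0 m1 N2 lam \<le> max_col_sum p' Nx m0 m1 N2 lam"
  unfolding max_col_sum_def
proof (rule Max.boundedI, goal_cases)
  case (3 x)
  define Y where "Y k = insert (col_C m0 m1 N2 (lam 0 k) (lam 1 k) (lam 2 k))
    ((\<lambda>j. col_F (p' j) m0 m1 N2 (lam 0 k) (lam 1 k) (lam 2 k) j) ` {1..m1 - 1})" for k
  have "\<exists>k<Nx. \<exists>y\<in>Y k. x \<le> y"
  proof -
    have "col_F (p j) m0 m1 N2 (lam 0 k) (lam 1 k) (lam 2 k) j \<le>
        col_F (p' j) m0 m1 N2 (lam 0 k) (lam 1 k) (lam 2 k) j"
      if "k < Nx" "j \<in> {1..m1 - 1}" for j k
      using that p[of j] geom_mono[OF lam[OF that(1)], of "p j" "p' j"]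
      by (auto simp: col_F_def intro!: mult_left_mono)
    with 3 show ?thesis
      by (fastforce simp: Y_def)
  qed
  moreover have "finite (\<Union>k<Nx. Y k)"
    by (simp add: Y_def)
  ultimately show ?case
    unfolding Y_def[symmetric] by (meson Max_ge UN_I lessThan_iff order.trans)
qed (use \<open>0 < Nx\<close> in auto)

section \<open>The convergence factor\<close>

lemma conv_factor_le:
  assumes "\<And>i. vec_norm_2 (A *\<^sub>v e (Suc i)) \<le> B * vec_norm_2 (A *\<^sub>v e i)" and "0 \<le> B"
  shows "conv_factor A e \<le> B"
  unfolding conv_factor_def
proof (rule cSUP_least)
  fix i
  have "0 \<le> vec_norm_2 (A *\<^sub>v e i)"
    by (simp add: vec_norm_2_def)
  \<comment> \<open>A vanishing denominator makes the quotient 0, which is at most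
    \<open>B\<close>.\<close>
  then show "vec_norm_2 (A *\<^sub>v e (Suc i)) / vec_norm_2 (A *\<^sub>v e i) \<le> B"
    using assms by (cases "vec_norm_2 (A *\<^sub>v e i) = 0") (auto simp: divide_le_eq)
qed simp

text \<open>Since injection after prolongation is the identity, \<open>E_F\<close> acts on the range
  of \<open>P\<close> as \<open>E\<close> acts on coarse vectors. There the residual norm of
  \<open>P *\<^sub>v y\<close> is the norm of \<open>B *\<^sub>v y\<close>, and
  \<open>B E = G B\<close> reduces the bound to the Schur test for \<open>G\<close>.\<close>

lemma one_step_bound:
  fixes lam :: "nat \<Rightarrow> nat \<Rightarrow> complex" and Nx :: nat
  assumes Nx: "Nx \<ge> 1" and m: "m 0 \<ge> 1" "m 1 \<ge> 1"
    and N: "N 2 = n + 1" "N 1 = n * m 1 + 1" "N 0 = (N 1 - 1) * m 0 + 1"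
    and x: "x \<in> carrier_vec (N 1 * Nx)"
  defines "A \<equiv> A_op Nx N lam 0" and "P \<equiv> P_op Nx m N lam 0" and "E \<equiv> E_Delta Nx m N lam"
  shows "E_F Nx m N lam *\<^sub>v (P *\<^sub>v x) = P *\<^sub>v (E *\<^sub>v x)"
    and "vec_norm_2 (A *\<^sub>v (P *\<^sub>v (E *\<^sub>v x))) \<le>
      sqrt (mat_norm_1 E * mat_norm_inf E) * vec_norm_2 (A *\<^sub>v (P *\<^sub>v x))"
proof -
  define B where "B = diag_blocks Nx (N 1) (N 1) (\<lambda>k. bidiag (lam 0 k ^ m 0))"
  define G where "G = diag_blocks Nx (N 1) (N 1) (\<lambda>k r s.
      err (m 1) (lam 0 k ^ m 0) (lam 1 k) (lam 2 k) (n * m 1 - s) (n * m 1 - r))"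
  define R where "R = RI0_op Nx m N"
  have carriers: "A \<in> carrier_mat (N 0 * Nx) (N 0 * Nx)" "P \<in> carrier_mat (N 0 * Nx) (N 1 * Nx)"
    "E \<in> carrier_mat (N 1 * Nx) (N 1 * Nx)" "R \<in> carrier_mat (N 1 * Nx) (N 0 * Nx)"
    "B \<in> carrier_mat (N 1 * Nx) (N 1 * Nx)" "G \<in> carrier_mat (N 1 * Nx) (N 1 * Nx)"
    by (simp_all add: A_def P_def E_def R_def B_def G_def A_op_diag P_op_diag E_Delta_diag[OF m N] RI0_op_diag)
  have RP: "R * P = 1\<^sub>m (N 1 * Nx)"
    unfolding R_def P_def by (rule RI0_P_op[where m = m and N = N, OF m(1) N(3)])
  have "R *\<^sub>v (P *\<^sub>v x) = x"
    using assoc_mult_mat_vec[OF carriers(4,2) x] x by (simp add: RP)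
  moreover have "E_F Nx m N lam *\<^sub>v (P *\<^sub>v x) = P *\<^sub>v (E *\<^sub>v (R *\<^sub>v (P *\<^sub>v x)))"
    unfolding E_F_def P_def[symmetric] E_def[symmetric] R_def[symmetric]
    using carriers x by (simp add: assoc_mult_mat_vec[of _ "N 0 * Nx" "N 1 * Nx" _ "N 0 * Nx"]
        assoc_mult_mat_vec[of _ "N 0 * Nx" "N 1 * Nx" _ "N 1 * Nx"])
  ultimately show "E_F Nx m N lam *\<^sub>v (P *\<^sub>v x) = P *\<^sub>v (E *\<^sub>v x)"
    by simp
  have residual: "vec_norm_2 (A *\<^sub>v (P *\<^sub>v y)) = vec_norm_2 (B *\<^sub>v y)"
    if y: "y \<in> carrier_vec (N 1 * Nx)" for y
  proof -
    have "A *\<^sub>v (P *\<^sub>v y) = (A * P) *\<^sub>v y"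
      using carriers y by simp
    also have "A * P = transpose_mat R * B"
      unfolding A_def P_def R_def B_def by (rule A_P_op[where m = m and N = N, OF m(1) N(3)])
    also have "(transpose_mat R * B) *\<^sub>v y = transpose_mat R *\<^sub>v (B *\<^sub>v y)"
      using carriers y by (intro assoc_mult_mat_vec[of _ "N 0 * Nx" "N 1 * Nx" _ "N 1 * Nx"]) auto
    finally show ?thesis
      unfolding R_def using carriers y
      by (simp add: vec_norm_2_RI0_transpose[where m = m and N = N, OF m(1) N(3)])
  qed
  have "B *\<^sub>v (E *\<^sub>v x) = G *\<^sub>v (B *\<^sub>v x)"
    using residual_propagation[where m = m and N = N, OF m N, of Nx lam] carriers x
    unfolding B_def[symmetric] G_def[symmetric] E_def[symmetric]
    by (metis assoc_mult_mat_vec)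
  \<comment> \<open>The reflection exchanges the two norms, which leaves their product
    unchanged.\<close>
  moreover have "mat_norm_1 G = mat_norm_inf E" "mat_norm_inf G = mat_norm_1 E"
    unfolding G_def E_def E_Delta_diag[OF m N] unfolding N(2)
    by (rule mat_norm_1_transpose_reverse[where f = "\<lambda>k. err (m 1) (lam 0 k ^ m 0) (lam 1 k) (lam 2 k)"]
        mat_norm_inf_transpose_reverse[where f = "\<lambda>k. err (m 1) (lam 0 k ^ m 0) (lam 1 k) (lam 2 k)"])+
  moreover have "vec_norm_2 (G *\<^sub>v (B *\<^sub>v x)) \<le>
      sqrt (mat_norm_1 G * mat_norm_inf G) * vec_norm_2 (B *\<^sub>v x)"
    using carriers x Nx N by (intro schur_test[of _ "N 1 * Nx" "N 1 * Nx"]) auto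
  ultimately show "vec_norm_2 (A *\<^sub>v (P *\<^sub>v (E *\<^sub>v x))) \<le>
      sqrt (mat_norm_1 E * mat_norm_inf E) * vec_norm_2 (A *\<^sub>v (P *\<^sub>v x))"
    using carriers x by (simp add: residual mult.commute)
qed

theorem theorem4p9:
  fixes Nx :: nat and m N :: "nat \<Rightarrow> nat"
    and lam :: "nat \<Rightarrow> nat \<Rightarrow> complex"
  assumes "Nx \<ge> 1" and "m 0 \<ge> 1" and "m 1 \<ge> 1" and "N 2 \<ge> 2"
    and "\<And>l. l < 2 \<Longrightarrow> m l dvd N l - 1 \<and> N (Suc l) = (N l - 1) div m l + 1"
    and "\<And>l k. l \<le> 2 \<Longrightarrow> k < Nx \<Longrightarrow> cmod (lam l k) < 1"
  shows
    "(\<forall>e. e 0 \<in> carrier_vec (N 0 * Nx) \<longrightarrow>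
          (\<forall>i. e (Suc i) = E_F Nx m N lam *\<^sub>v e i) \<longrightarrow>
        (let B = sqrt (mat_norm_1 (E_Delta Nx m N lam) * mat_norm_inf (E_Delta Nx m N lam)) in
          conv_factor (A_op Nx N lam 0) (\<lambda>i. e (Suc i)) \<le> B \<and>
          (e 0 = P_op Nx m N lam 0 *\<^sub>v (RI0_op Nx m N *\<^sub>v e 0) \<longrightarrow>
            conv_factor (A_op Nx N lam 0) e \<le> B))) \<and>
     mat_norm_1 (E_Delta Nx m N lam) = max_col_sum (\<lambda>j. j - 1) Nx (m 0) (m 1) (N 2) lam \<and>
     mat_norm_1 (E_Delta Nx m N lam) \<le> max_col_sum (\<lambda>_. m 1 - 2) Nx (m 0) (m 1) (N 2) lam \<and>
     (m 1 \<le> 2 \<longrightarrow>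
       mat_norm_1 (E_Delta Nx m N lam) = max_col_sum (\<lambda>_. m 1 - 2) Nx (m 0) (m 1) (N 2) lam) \<and>
     mat_norm_inf (E_Delta Nx m N lam) = max_row_sum Nx (m 0) (m 1) (N 2) lam"
proof -
  note Nx = assms(1) and m = assms(2,3) and lam = assms(6)
  define n where "n = N 2 - 1"
  have n: "n \<ge> 1" and N2: "N 2 = n + 1"
    using assms(4) by (simp_all add: n_def)
  have dvd: "m 0 dvd N 0 - 1" "m 1 dvd N 1 - 1"
    and N': "N 1 = (N 0 - 1) div m 0 + 1" "N 2 = (N 1 - 1) div m 1 + 1"
    using assms(5)[of 0] assms(5)[of 1] by (simp_all add: numeral_2_eq_2)
  have "N 1 - 1 = n * m 1"
    using dvd(2) N'(2) N2 by simp
  then have N1: "N 1 = n * m 1 + 1"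
    using N'(1) by simp
  have N0': "N 0 - 1 = (N 1 - 1) * m 0"
    using dvd(1) N'(1) by simp
  \<comment> \<open>Excludes \<open>N 0 = 0\<close>, for which the truncated \<open>N 0 - 1\<close>
    would not determine \<open>N 0\<close>.\<close>
  then have "N 0 - 1 > 0"
    using N1 n m by simp
  then have N0: "N 0 = (N 1 - 1) * m 0 + 1"
    using N0' by simp
  note N = N2 N1 N0
  define A P R E B where "A = A_op Nx N lam 0" and "P = P_op Nx m N lam 0"
    and "R = RI0_op Nx m N" and "E = E_Delta Nx m N lam"
    and "B = sqrt (mat_norm_1 E * mat_norm_inf E)"
  have norm1: "mat_norm_1 E = max_col_sum (\<lambda>j. j - 1) Nx (m 0) (m 1) (N 2) lam"
    unfolding E_def by (rule mat_norm_1_E_Delta[OF Nx m n N lam])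
  have norm_inf: "mat_norm_inf E = max_row_sum Nx (m 0) (m 1) (N 2) lam"
    unfolding E_def by (rule mat_norm_inf_E_Delta[OF Nx m n N lam])
  have carriers: "P \<in> carrier_mat (N 0 * Nx) (N 1 * Nx)" "E \<in> carrier_mat (N 1 * Nx) (N 1 * Nx)"
    "R \<in> carrier_mat (N 1 * Nx) (N 0 * Nx)"
    by (simp_all add: P_def E_def R_def P_op_diag E_Delta_diag[OF m N] RI0_op_diag)
  have B0: "0 \<le> B"
  proof -
    have "0 < N 1 * Nx"
      using Nx N1 by simp
    then have "0 \<le> mat_norm_1 E" and "0 \<le> mat_norm_inf E"
      unfolding mat_norm_1_def mat_norm_inf_def using carriers(2)
      by (auto intro!: order.trans[OF _ Max_ge[OF _ imageI[of 0]]] sum_nonneg)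
    then show ?thesis
      by (simp add: B_def)
  qed
  \<comment> \<open>The range of \<open>P\<close> is invariant under the iteration, so a start in it
    makes \<open>one_step_bound\<close> apply at every step.\<close>
  have conv: "conv_factor A e \<le> B"
    if x: "x \<in> carrier_vec (N 1 * Nx)" "e 0 = P *\<^sub>v x"
      and e: "\<And>i. e (Suc i) = E_F Nx m N lam *\<^sub>v e i" for e x
  proof -
    note step = one_step_bound[where m = m and N = N and lam = lam, OF Nx m N,
        folded A_def P_def E_def B_def]
    have range_P: "\<exists>x\<in>carrier_vec (N 1 * Nx). e i = P *\<^sub>v x" for i
    proof (induction i)
      case (Suc i)
      then obtain x where "x \<in> carrier_vec (N 1 * Nx)" "e i = P *\<^sub>v x" by blast
      then have "e (Suc i) = P *\<^sub>v (E *\<^sub>v x)" "E *\<^sub>v x \<in> carrier_vec (N 1 * Nx)"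
        using e step(1) carriers by auto
      then show ?case by blast
    qed (use x in blast)
    show ?thesis
    proof (rule conv_factor_le[OF _ B0])
      fix i
      obtain x where "x \<in> carrier_vec (N 1 * Nx)" "e i = P *\<^sub>v x"
        using range_P by blast
      then show "vec_norm_2 (A *\<^sub>v e (Suc i)) \<le> B * vec_norm_2 (A *\<^sub>v e i)"
        using e step by simp
    qed
  qed
  \<comment> \<open>Every first iterate lies in the range of \<open>P\<close>, because
    \<open>P\<close> is the leftmost factor of \<open>E_F\<close>.\<close>
  have "conv_factor A (\<lambda>i. e (Suc i)) \<le> B"
    if e0: "e 0 \<in> carrier_vec (N 0 * Nx)" and e: "\<forall>i. e (Suc i) = E_F Nx m N lam *\<^sub>v e i" for e
  proof (rule conv)
    show "E *\<^sub>v (R *\<^sub>v e 0) \<in> carrier_vec (N 1 * Nx)"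
      using carriers e0 by simp
    show "e (Suc 0) = P *\<^sub>v (E *\<^sub>v (R *\<^sub>v e 0))"
      using e carriers e0 unfolding E_F_def P_def[symmetric] E_def[symmetric] R_def[symmetric]
      by (simp add: assoc_mult_mat_vec[of _ "N 0 * Nx" "N 1 * Nx" _ "N 0 * Nx"]
        assoc_mult_mat_vec[of _ "N 0 * Nx" "N 1 * Nx" _ "N 1 * Nx"])
  qed (use e in simp)
  moreover have "conv_factor A e \<le> B"
    if "e 0 \<in> carrier_vec (N 0 * Nx)" and "\<forall>i. e (Suc i) = E_F Nx m N lam *\<^sub>v e i"
      and "e 0 = P *\<^sub>v (R *\<^sub>v e 0)" for e
    using conv[of "R *\<^sub>v e 0" e] carriers that by simp
  moreover have "mat_norm_1 E \<le> max_col_sum (\<lambda>_. m 1 - 2) Nx (m 0) (m 1) (N 2) lam"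
    unfolding norm1 using Nx lam by (intro max_col_sum_mono) auto
  \<comment> \<open>For \<open>m 1 \<le> 2\<close> the only possible index is \<open>j = 1\<close>,
    where both exponents are 0.\<close>
  moreover have "max_col_sum (\<lambda>j. j - 1) Nx (m 0) (m 1) (N 2) lam =
      max_col_sum (\<lambda>_. m 1 - 2) Nx (m 0) (m 1) (N 2) lam" if "m 1 \<le> 2"
    using Nx lam that by (intro antisym max_col_sum_mono) auto
  ultimately show ?thesis
    using norm1 norm_inf unfolding A_def P_def R_def E_def B_def Let_def by simp
qed

end
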